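(* Let $p>2$ and $g(u)=|u|^{p-2}u$, and assume $(a_* )$, $(a_+)$ and $(a_0)$. Let $\Lambda>0$ be such that for every $\lambda>\Lambda$ the problem $$-\operatorname{div}\left(\frac{\nabla u}{\sqrt{1-|\nabla u|^2}}\right)=\lambda a(x)|u|^{p-2}u\ \text{ in }\Omega,\qquad \frac{\nabla u}{\sqrt{1-|\nabla u|^2}}\cdot\mathbf n=0\ \text{ on }\partial\Omega$$ admits a non-trivial solution with $I_\lambda$-value equal to $\inf_{C(\overline\Omega)}I_\lambda<0$ (such a $\Lambda$ exists). For every $\lambda>\Lambda$, let $u_\lambda^{(l)}$ be such a (ground-state) solution, and let $u_\lambda^{(s)}$ be the mountain-pass solution of the problem, characterized by its energy level $I_\lambda(u_\lambda^{(s)})=c_\lambda$, where $$c_\lambda:=\inf_{f\in\Gamma}\sup_{t\in[0,1]}I_\lambda(f(t)),\qquad \Gamma:=\{f\in C([0,1],C(\overline\Omega)): f(0)=0,\ f(1)=u_\lambda^{(l)}\}.$$ Then $$c_\lambda=O\left(\lambda^{-\frac{2}{p-2}}\right)\quad\text{and}\quad u_\lambda^{(s)}\to0\ \text{ in }C(\overline\Omega)$$ as $\lambda\to+\infty$.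
   Context: $\Omega\subset\mathbb R^N$ is a bounded convex domain, $N\ge2$, with $\partial\Omega\in C^2$, and $\mathbf n$ is the exterior normal vector; $a:\Omega\to\mathbb R$. Hypotheses: - $(a_* )$: $a\in L^\infty(\Omega)$ and $\int_\Omega a(x)\,dx<0$. - $(a_+)$: the set $\{x\in\Omega: a(x)>0\}$ has nonempty interior. - $(a_0)$: $|\{x\in\Omega:a(x)=0\}|=0$. Solution: $u\in W^{1,\infty}(\Omega)$ with $\|\nabla u\|_{L^\infty(\Omega)}<1$ and $\int_\Omega\frac{\nabla u\cdot\nabla\phi}{\sqrt{1-|\nabla u|^2}}\,dx=\lambda\int_\Omega a(x)|u|^{p-2}u\,\phi\,dx$ for every $\phi\in C^1(\overline\Omega)$. $K:=\{u\in W^{1,\infty}(\Omega):\|\nabla u\|_{L^\infty(\Omega)}\le1\}\subset C(\overline\Omega)$. The functional $I_\lambda:C(\overline\Omega)\to(-\infty,+\infty]$ is $I_\lambda=\Psi+\Phi_\lambda$, where $\Psi(u)=\int_\Omega(1-\sqrt{1-|\nabla u|^2})\,dx$ if $u\in K$, $\Psi(u)=+\infty$ if $u\in C(\overline\Omega)\setminus K$, and $\Phi_\lambda(u)=-\frac{\lambda}{p}\int_\Omega a(x)|u|^p\,dx$. *)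

theory Defs
  imports "HOL-Analysis.Analysis" "HOL-Probability.Essential_Supremum" "HOL-Library.Landau_Symbols"
begin

text \<open>
  Functions on \<open>\<Omega>\<close> or on its closure are total functions on the ambient Euclidean space whose values
  elsewhere are never used. Measurability, integrals and essential suprema over \<open>\<Omega>\<close> refer to
  \<^term>\<open>lebesgue_on \<Omega>\<close>.
\<close>

text \<open>
  In the local graph representation, \<open>e\<close> is the vertical direction and \<open>y \<mapsto> y - (y \<bullet> e) *\<^sub>R e\<close> the
  orthogonal projection onto the hyperplane orthogonal to \<open>e\<close>. The graph function \<open>\<gamma>\<close> is only ever
  evaluated on that hyperplane; \<open>g\<close> and \<open>H\<close> are its gradient and its (continuous) Hessian.
\<close>

definition C2_function :: "('a::euclidean_space \<Rightarrow> real) \<Rightarrow> bool" where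
  "C2_function \<gamma> \<longleftrightarrow>
     (\<exists>(g :: 'a \<Rightarrow> 'a) (H :: 'a \<Rightarrow> 'a \<Rightarrow>\<^sub>L 'a).
        (\<forall>x. GDERIV \<gamma> x :> g x) \<and>
        (\<forall>x. (g has_derivative blinfun_apply (H x)) (at x)) \<and>
        continuous_on UNIV H)"

definition C2_boundary :: "'a::euclidean_space set \<Rightarrow> bool" where
  "C2_boundary \<Omega> \<longleftrightarrow>
     (\<forall>x\<^sub>0 \<in> frontier \<Omega>. \<exists>r e \<gamma>. r > 0 \<and> norm e = 1 \<and> C2_function \<gamma> \<and>
        \<Omega> \<inter> ball x\<^sub>0 r = {x \<in> ball x\<^sub>0 r. \<gamma> (x - (x \<bullet> e) *\<^sub>R e) < x \<bullet> e})"

definition Linf_norm :: "'a::euclidean_space set \<Rightarrow> ('a \<Rightarrow> 'b::euclidean_space) \<Rightarrow> ereal" where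
  "Linf_norm \<Omega> f = esssup (lebesgue_on \<Omega>) (\<lambda>x. ereal (norm (f x)))"

definition Linf :: "'a::euclidean_space set \<Rightarrow> ('a \<Rightarrow> 'b::euclidean_space) set" where
  "Linf \<Omega> = {f. f \<in> borel_measurable (lebesgue_on \<Omega>) \<and> Linf_norm \<Omega> f < \<infinity>}"

text \<open>
  \<open>\<phi> \<in> C\<^sup>1\<^sub>c(\<Omega>)\<close>, extended by zero to the whole space, with gradient \<open>g\<close>.
\<close>

definition test_function :: "'a::euclidean_space set \<Rightarrow> ('a \<Rightarrow> real) \<Rightarrow> ('a \<Rightarrow> 'a) \<Rightarrow> bool" where
  "test_function \<Omega> \<phi> g \<longleftrightarrow>
     (\<forall>x. GDERIV \<phi> x :> g x) \<and> continuous_on UNIV g \<and>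
     (\<exists>S. compact S \<and> S \<subseteq> \<Omega> \<and> (\<forall>x. x \<notin> S \<longrightarrow> \<phi> x = 0))"

text \<open>
  \<open>\<phi> \<in> C\<^sup>1(closure \<Omega>)\<close>: \<open>\<phi>\<close> is continuously differentiable in \<open>\<Omega>\<close>, and \<open>\<phi>\<close> and its gradient extend
  continuously to the closure; \<open>g\<close> is the extended gradient.
\<close>

definition C1_closure :: "'a::euclidean_space set \<Rightarrow> ('a \<Rightarrow> real) \<Rightarrow> ('a \<Rightarrow> 'a) \<Rightarrow> bool" where
  "C1_closure \<Omega> \<phi> g \<longleftrightarrow>
     continuous_on (closure \<Omega>) \<phi> \<and> continuous_on (closure \<Omega>) g \<and>
     (\<forall>x\<in>\<Omega>. GDERIV \<phi> x :> g x)"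

text \<open>
  Weak gradients are defined by testing with \<open>C\<^sup>1\<^sub>c(\<Omega>)\<close>, as in Gilbarg and Trudinger; testing with
  \<open>C\<^sup>\<infinity>\<^sub>c(\<Omega>)\<close> gives the same notion, by mollification.
\<close>

definition has_weak_gradient ::
    "'a::euclidean_space set \<Rightarrow> ('a \<Rightarrow> real) \<Rightarrow> ('a \<Rightarrow> 'a) \<Rightarrow> bool" where
  "has_weak_gradient \<Omega> u G \<longleftrightarrow>
     (\<forall>\<phi> g. test_function \<Omega> \<phi> g \<longrightarrow>
        (\<forall>b\<in>Basis. (LINT x|lebesgue_on \<Omega>. u x * (g x \<bullet> b)) =
                   - (LINT x|lebesgue_on \<Omega>. (G x \<bullet> b) * \<phi> x)))"

definition W1inf :: "'a::euclidean_space set \<Rightarrow> ('a \<Rightarrow> real) set" where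
  "W1inf \<Omega> = {u \<in> Linf \<Omega>. \<exists>G \<in> Linf \<Omega>. has_weak_gradient \<Omega> u G}"

text \<open>The weak gradient of \<open>u \<in> W1inf \<Omega>\<close> is unique almost everywhere; this picks a representative.\<close>

definition weak_grad :: "'a::euclidean_space set \<Rightarrow> ('a \<Rightarrow> real) \<Rightarrow> 'a \<Rightarrow> 'a" where
  "weak_grad \<Omega> u = (SOME G. G \<in> Linf \<Omega> \<and> has_weak_gradient \<Omega> u G)"

definition C_closure :: "'a::euclidean_space set \<Rightarrow> ('a \<Rightarrow> real) set" where
  "C_closure \<Omega> = {u. continuous_on (closure \<Omega>) u}"

text \<open>
  Elements of \<open>W1inf \<Omega>\<close> are regarded as elements of \<open>C(closure \<Omega>)\<close> through their continuous
  representatives, hence the intersections with \<^const>\<open>C_closure\<close> below.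
\<close>

definition K_set :: "'a::euclidean_space set \<Rightarrow> ('a \<Rightarrow> real) set" where
  "K_set \<Omega> = {u \<in> C_closure \<Omega> \<inter> W1inf \<Omega>. Linf_norm \<Omega> (weak_grad \<Omega> u) \<le> 1}"

definition Psi :: "'a::euclidean_space set \<Rightarrow> ('a \<Rightarrow> real) \<Rightarrow> ereal" where
  "Psi \<Omega> u =
     (if u \<in> K_set \<Omega>
      then ereal (LINT x|lebesgue_on \<Omega>. 1 - sqrt (1 - (norm (weak_grad \<Omega> u x))\<^sup>2))
      else \<infinity>)"

definition Phi ::
    "'a::euclidean_space set \<Rightarrow> ('a \<Rightarrow> real) \<Rightarrow> real \<Rightarrow> real \<Rightarrow> ('a \<Rightarrow> real) \<Rightarrow> real" where
  "Phi \<Omega> a p lam u = - (lam / p) * (LINT x|lebesgue_on \<Omega>. a x * \<bar>u x\<bar> powr p)"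

definition energy ::
    "'a::euclidean_space set \<Rightarrow> ('a \<Rightarrow> real) \<Rightarrow> real \<Rightarrow> real \<Rightarrow> ('a \<Rightarrow> real) \<Rightarrow> ereal" where
  "energy \<Omega> a p lam u = Psi \<Omega> u + ereal (Phi \<Omega> a p lam u)"

text \<open>
  The Neumann boundary condition is encoded by the test functions, which need not vanish on the
  boundary.
\<close>

definition is_solution ::
    "'a::euclidean_space set \<Rightarrow> ('a \<Rightarrow> real) \<Rightarrow> real \<Rightarrow> real \<Rightarrow> ('a \<Rightarrow> real) \<Rightarrow> bool" where
  "is_solution \<Omega> a p lam u \<longleftrightarrow>
     u \<in> C_closure \<Omega> \<inter> W1inf \<Omega> \<and> Linf_norm \<Omega> (weak_grad \<Omega> u) < 1 \<and>
     (\<forall>\<phi> g. C1_closure \<Omega> \<phi> g \<longrightarrow>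
        (LINT x|lebesgue_on \<Omega>.
           (weak_grad \<Omega> u x \<bullet> g x) / sqrt (1 - (norm (weak_grad \<Omega> u x))\<^sup>2)) =
        lam * (LINT x|lebesgue_on \<Omega>. a x * (\<bar>u x\<bar> powr (p - 2) * u x) * \<phi> x))"

definition is_ground_state ::
    "'a::euclidean_space set \<Rightarrow> ('a \<Rightarrow> real) \<Rightarrow> real \<Rightarrow> real \<Rightarrow> ('a \<Rightarrow> real) \<Rightarrow> bool" where
  "is_ground_state \<Omega> a p lam u \<longleftrightarrow>
     is_solution \<Omega> a p lam u \<and> (\<exists>x\<in>\<Omega>. u x \<noteq> 0) \<and>
     energy \<Omega> a p lam u = (INF v\<in>C_closure \<Omega>. energy \<Omega> a p lam v) \<and>
     (INF v\<in>C_closure \<Omega>. energy \<Omega> a p lam v) < 0"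

text \<open>Continuous paths \<open>[0,1] \<rightarrow> C(closure \<Omega>)\<close>, with respect to the supremum norm, from \<open>0\<close> to \<open>w\<close>.\<close>

definition paths_to :: "'a::euclidean_space set \<Rightarrow> ('a \<Rightarrow> real) \<Rightarrow> (real \<Rightarrow> 'a \<Rightarrow> real) set" where
  "paths_to \<Omega> w =
     {f. (\<forall>t\<in>{0..1}. f t \<in> C_closure \<Omega>) \<and>
         (\<forall>t\<in>{0..1}. uniform_limit (closure \<Omega>) f (f t) (at t within {0..1})) \<and>
         (\<forall>x\<in>closure \<Omega>. f 0 x = 0) \<and> (\<forall>x\<in>closure \<Omega>. f 1 x = w x)}"

definition mountain_pass_level ::
    "'a::euclidean_space set \<Rightarrow> ('a \<Rightarrow> real) \<Rightarrow> real \<Rightarrow> real \<Rightarrow> ('a \<Rightarrow> real) \<Rightarrow> ereal" where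
  "mountain_pass_level \<Omega> a p lam w =
     (INF f\<in>paths_to \<Omega> w. SUP t\<in>{0..1}. energy \<Omega> a p lam (f t))"

end

theory Submission
  imports Defs "HOL-Complex_Analysis.Great_Picard"
begin

text \<open>
  Write \<open>V\<close> for the volume of \<open>\<Omega>\<close>, \<open>W(u)\<close> for the integral of \<open>a |u|^p\<close>, and \<open>\<psi>(u)\<close> for the integral of
  \<open>1 - sqrt (1 - |\<nabla>u|^2)\<close>, so that the energy of \<open>u\<close> is \<open>\<psi>(u) - (\<lambda>/p) W(u)\<close> on functions whose gradient
  is bounded by \<open>1\<close>, and there \<open>0 \<le> \<psi>(u) \<le> V\<close>.

  \<^emph>\<open>The level.\<close> Every admissible path starts at a function of energy \<open>0\<close>, hence \<open>c \<ge> 0\<close>. For the upper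
  bound the straight path \<open>t \<mapsto> t u\<close> to the ground state \<open>u\<close> is good enough. On it \<open>\<psi>(t u) \<le> t^2 V\<close>,
  because \<open>1 - sqrt (1 - y) \<le> y\<close>, and \<open>W(t u) = t^p W(u)\<close>. Comparing the energy of the minimiser \<open>u\<close>
  with that of one fixed bump \<open>\<phi>\<close> supported where \<open>a > 0\<close> gives \<open>W(u) \<ge> W(\<phi>)/2\<close> for large \<open>\<lambda>\<close>. So the energy along the
  path is at most \<open>t^2 V - \<lambda> B t^p\<close> with a constant \<open>B > 0\<close>, and the maximum of this function
  of \<open>t\<close> is of order \<open>\<lambda>^(-2/(p-2))\<close> (\<open>scaling_maximum\<close>, \<open>mountain_pass_level_le\<close>).

  \<^emph>\<open>The solutions.\<close> Let \<open>u\<close> be a solution of nonnegative energy, so that \<open>\<lambda> W(u) \<le> p \<psi>(u) \<le> p V\<close>.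
  Testing the equation with \<open>u\<close> itself shows that \<open>|\<nabla>u|^2 / sqrt (1 - |\<nabla>u|^2)\<close> has integral \<open>\<lambda> W(u)\<close>
  (\<open>solution_tested_with_itself\<close>). Hence \<open>1 / sqrt (1 - |\<nabla>u|^2)\<close> has integral at most \<open>(1 + p) V\<close>, and
  testing with a fixed \<open>\<phi>\<close> shows that \<open>\<lambda>\<close> times the integral of \<open>a |u|^(p-2) u \<phi>\<close> stays bounded as \<open>\<lambda>\<close>
  grows (\<open>solution_weak_bound\<close>). For constant \<open>\<phi>\<close> that integral even vanishes; as the integral of \<open>a\<close> is
  negative, a solution with oscillation bounded by the diameter can then not be
  large (\<open>uniform_bound\<close>). If the solutions did not tend to \<open>0\<close>, the Arzela-Ascoli theorem would give
  a uniform limit \<open>g \<noteq> 0\<close> along some sequence \<open>\<lambda> \<rightarrow> \<infinity>\<close>. But \<open>a |g|^(p-2) g\<close> is orthogonal to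
  all test functions, hence \<open>0\<close> almost everywhere, and \<open>g = 0\<close> because \<open>a \<noteq> 0\<close> almost everywhere.

  \<^emph>\<open>Regularity.\<close> Both the Lipschitz bound behind Arzela-Ascoli and the use of \<open>u\<close> as a test
  function rest on one approximation: on a convex domain a function whose weak gradient
  is bounded by \<open>L\<close> is a uniform limit of \<open>C\<^sup>1\<close> functions with gradient bounded by the same \<open>L\<close>
  (\<open>smooth_approximation\<close>). Under such a convergence the gradients converge weakly against bounded
  functions (\<open>weak_gradient_limit\<close>).
\<close>

section \<open>Essentially bounded functions on a bounded open set\<close>

locale bounded_open_set =
  fixes \<Omega> :: "'a::euclidean_space set"
  assumes open_dom: "open \<Omega>" and nonempty_dom: "\<Omega> \<noteq> {}" and bounded_dom: "bounded \<Omega>"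
begin

abbreviation \<mu> :: "'a measure" where "\<mu> \<equiv> lebesgue_on \<Omega>"

lemma dom_lebesgue: "\<Omega> \<in> sets lebesgue"
  using open_dom by simp

lemma dom_lmeasurable: "\<Omega> \<in> lmeasurable"
  using open_dom bounded_dom by (simp add: lmeasurable_open)

lemma finite_measure_dom: "finite_measure \<mu>"
  using dom_lmeasurable by (rule finite_measure_lebesgue_on)

lemma AE_domI: "(\<And>x. x \<in> \<Omega> \<Longrightarrow> P x) \<Longrightarrow> AE x in \<mu>. P x"
  by (rule AE_I2) simp

lemma Linf_iff:
  fixes f :: "'a \<Rightarrow> 'b::euclidean_space"
  shows "f \<in> Linf \<Omega> \<longleftrightarrow> f \<in> borel_measurable \<mu> \<and> (\<exists>C\<ge>0. AE x in \<mu>. norm (f x) \<le> C)"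
proof (intro iffI conjI)
  assume f: "f \<in> Linf \<Omega>"
  then show m: "f \<in> borel_measurable \<mu>" by (simp add: Linf_def)
  have "Linf_norm \<Omega> f < \<infinity>" using f by (simp add: Linf_def)
  then obtain C where C: "Linf_norm \<Omega> f < ereal C"
    by (metis ereal_dense2 ereal_infty_less(1) less_ereal.simps(2) less_top top_ereal_def)
  have "AE x in \<mu>. norm (f x) \<le> max 0 C"
    using esssup_AE[of "\<lambda>x. ereal (norm (f x))" \<mu>]
  proof eventually_elim
    case (elim x)
    then have "ereal (norm (f x)) < ereal C" using C unfolding Linf_norm_def by (rule le_less_trans)
    then show ?case by simp
  qed
  then show "\<exists>C\<ge>0. AE x in \<mu>. norm (f x) \<le> C" by (intro exI[of _ "max 0 C"]) auto
next
  assume "f \<in> borel_measurable \<mu> \<and> (\<exists>C\<ge>0. AE x in \<mu>. norm (f x) \<le> C)"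
  then obtain C where m: "f \<in> borel_measurable \<mu>" and C: "AE x in \<mu>. norm (f x) \<le> C" by blast
  have "Linf_norm \<Omega> f \<le> ereal C"
    unfolding Linf_norm_def using C by (intro esssup_I) (use m in auto)
  then show "f \<in> Linf \<Omega>" using m by (auto simp: Linf_def le_less_trans)
qed

lemma Linf_I:
  fixes f :: "'a \<Rightarrow> 'b::euclidean_space"
  shows "f \<in> borel_measurable \<mu> \<Longrightarrow> AE x in \<mu>. norm (f x) \<le> C \<Longrightarrow> f \<in> Linf \<Omega>"
  unfolding Linf_iff by (rule conjI, assumption, rule exI[of _ "max 0 C"]) (auto elim: eventually_mono)

lemma Linf_measurable [measurable_dest]:
  fixes f :: "'a \<Rightarrow> 'b::euclidean_space"
  shows "f \<in> Linf \<Omega> \<Longrightarrow> f \<in> borel_measurable \<mu>"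
  by (simp add: Linf_iff)

lemma Linf_boundE:
  fixes f :: "'a \<Rightarrow> 'b::euclidean_space"
  assumes "f \<in> Linf \<Omega>"
  obtains C where "C \<ge> 0" "AE x in \<mu>. norm (f x) \<le> C"
  using assms by (auto simp: Linf_iff)

lemma Linf_integrable:
  fixes f :: "'a \<Rightarrow> 'b::euclidean_space"
  assumes "f \<in> Linf \<Omega>" shows "integrable \<mu> f"
  using assms finite_measure.integrable_const_bound[OF finite_measure_dom] by (auto simp: Linf_iff)

lemma Linf_const [simp]: "(\<lambda>x. k::'b::euclidean_space) \<in> Linf \<Omega>"
  by (rule Linf_I[of _ "norm k"]) auto

lemma Linf_add:
  fixes f g :: "'a \<Rightarrow> 'b::euclidean_space"
  assumes "f \<in> Linf \<Omega>" "g \<in> Linf \<Omega>" shows "(\<lambda>x. f x + g x) \<in> Linf \<Omega>"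
proof -
  obtain A B where "AE x in \<mu>. norm (f x) \<le> A" "AE x in \<mu>. norm (g x) \<le> B"
    using assms by (auto simp: Linf_iff)
  then have "AE x in \<mu>. norm (f x + g x) \<le> A + B"
    by eventually_elim (use norm_triangle_mono in blast)
  then show ?thesis using assms by (intro Linf_I) (auto simp: Linf_iff)
qed

lemma Linf_scaleR:
  fixes f :: "'a \<Rightarrow> real" and g :: "'a \<Rightarrow> 'b::euclidean_space"
  assumes "f \<in> Linf \<Omega>" "g \<in> Linf \<Omega>" shows "(\<lambda>x. f x *\<^sub>R g x) \<in> Linf \<Omega>"
proof -
  obtain A B where "A \<ge> 0" "AE x in \<mu>. norm (f x) \<le> A" "B \<ge> 0" "AE x in \<mu>. norm (g x) \<le> B"
    using assms by (auto simp: Linf_iff)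
  then have "AE x in \<mu>. norm (f x *\<^sub>R g x) \<le> A * B"
    by (auto elim!: eventually_elim2 simp: mult_mono)
  then show ?thesis using assms by (intro Linf_I) (auto simp: Linf_iff)
qed

lemma Linf_mult:
  fixes f g :: "'a \<Rightarrow> real"
  shows "f \<in> Linf \<Omega> \<Longrightarrow> g \<in> Linf \<Omega> \<Longrightarrow> (\<lambda>x. f x * g x) \<in> Linf \<Omega>"
  using Linf_scaleR[of f g] by simp

lemma Linf_inner:
  fixes f g :: "'a \<Rightarrow> 'b::euclidean_space"
  assumes "f \<in> Linf \<Omega>" "g \<in> Linf \<Omega>" shows "(\<lambda>x. f x \<bullet> g x) \<in> Linf \<Omega>"
proof -
  obtain A B where "A \<ge> 0" "AE x in \<mu>. norm (f x) \<le> A" "B \<ge> 0" "AE x in \<mu>. norm (g x) \<le> B"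
    using assms by (auto simp: Linf_iff)
  then have "AE x in \<mu>. norm (f x \<bullet> g x) \<le> A * B"
    by (auto elim!: eventually_elim2 intro!: order_trans[OF Cauchy_Schwarz_ineq2] mult_mono)
  then show ?thesis using assms by (intro Linf_I) (auto simp: Linf_iff)
qed

lemma Linf_minus:
  fixes f :: "'a \<Rightarrow> 'b::euclidean_space"
  shows "f \<in> Linf \<Omega> \<Longrightarrow> (\<lambda>x. - f x) \<in> Linf \<Omega>"
  using Linf_scaleR[of "\<lambda>_. - 1" f] by simp

lemma Linf_diff:
  fixes f g :: "'a \<Rightarrow> 'b::euclidean_space"
  shows "f \<in> Linf \<Omega> \<Longrightarrow> g \<in> Linf \<Omega> \<Longrightarrow> (\<lambda>x. f x - g x) \<in> Linf \<Omega>"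
  using Linf_add[of f "\<lambda>x. - g x"] Linf_minus[of g] by simp

lemma Linf_continuous:
  fixes f :: "'a \<Rightarrow> 'b::euclidean_space"
  assumes "continuous_on (closure \<Omega>) f" shows "f \<in> Linf \<Omega>"
proof -
  have "compact (closure \<Omega>)" using bounded_dom by (simp add: compact_closure)
  then have "bounded (f ` closure \<Omega>)" using assms by (intro compact_imp_bounded compact_continuous_image)
  then obtain C where "\<forall>y\<in>f ` closure \<Omega>. norm y \<le> C" unfolding bounded_iff by blast
  then have C: "norm (f x) \<le> C" if "x \<in> closure \<Omega>" for x using that by simp
  have "continuous_on \<Omega> f" using assms closure_subset continuous_on_subset by blast
  then have "f \<in> borel_measurable \<mu>"
    using dom_lebesgue by (rule continuous_imp_measurable_on_sets_lebesgue)
  then show ?thesis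
    by (rule Linf_I[of _ C]) (use C closure_subset in \<open>auto intro!: AE_domI\<close>)
qed

lemma Linf_compose:
  fixes f :: "'a \<Rightarrow> 'b::euclidean_space" and j :: "'b \<Rightarrow> 'c::euclidean_space"
  assumes f: "f \<in> Linf \<Omega>" and j: "continuous_on UNIV j" shows "(\<lambda>x. j (f x)) \<in> Linf \<Omega>"
proof -
  obtain A where A: "AE x in \<mu>. norm (f x) \<le> A" using f by (auto simp: Linf_iff)
  have "bounded (j ` cball 0 A)"
    using j by (intro compact_imp_bounded compact_continuous_image) (auto intro: continuous_on_subset)
  then obtain C where "\<forall>z\<in>j ` cball 0 A. norm z \<le> C" unfolding bounded_iff by blast
  then have C: "norm (j y) \<le> C" if "norm y \<le> A" for y using that by simp
  have "AE x in \<mu>. norm (j (f x)) \<le> C" using A by eventually_elim (rule C)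
  moreover have "(\<lambda>x. j (f x)) \<in> borel_measurable \<mu>"
    using borel_measurable_continuous_onI[OF j] Linf_measurable[OF f] by measurable
  ultimately show ?thesis by (intro Linf_I)
qed

lemma integral_bounded_convergence:
  fixes f :: "nat \<Rightarrow> 'a \<Rightarrow> real"
  assumes "\<And>n. f n \<in> borel_measurable \<mu>" "F \<in> borel_measurable \<mu>"
    and "AE x in \<mu>. (\<lambda>n. f n x) \<longlonglongrightarrow> F x" "\<And>n. AE x in \<mu>. \<bar>f n x\<bar> \<le> C"
  shows "(\<lambda>n. LINT x|\<mu>. f n x) \<longlonglongrightarrow> (LINT x|\<mu>. F x)"
  using assms
  by (intro integral_dominated_convergence[where w="\<lambda>_. C"])
     (auto simp: finite_measure.integrable_const[OF finite_measure_dom])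

end

section \<open>Continuously differentiable functions and bumps\<close>

definition C1_fun :: "('a::euclidean_space \<Rightarrow> real) \<Rightarrow> ('a \<Rightarrow> 'a) \<Rightarrow> bool" where
  "C1_fun w h \<longleftrightarrow> (\<forall>x. GDERIV w x :> h x) \<and> continuous_on UNIV h"

lemma C1_fun_GDERIV: "C1_fun w h \<Longrightarrow> GDERIV w x :> h x"
  by (simp add: C1_fun_def)

lemma C1_fun_continuous: "C1_fun w h \<Longrightarrow> continuous_on S w"
  unfolding C1_fun_def gderiv_def
  by (rule has_derivative_continuous_on) (blast intro: has_derivative_at_withinI)

lemma C1_fun_continuous_grad: "C1_fun w h \<Longrightarrow> continuous_on S h"
  unfolding C1_fun_def by (blast intro: continuous_on_subset)

lemma C1_fun_cong: "C1_fun w h \<Longrightarrow> (\<And>x. w x = w' x) \<Longrightarrow> (\<And>x. h x = h' x) \<Longrightarrow> C1_fun w' h'"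
  by (drule ext, drule ext) simp

lemma C1_fun_const: "C1_fun (\<lambda>x. k) (\<lambda>x. 0)"
  by (simp add: C1_fun_def GDERIV_const)

lemma C1_fun_add: "C1_fun w h \<Longrightarrow> C1_fun w' h' \<Longrightarrow> C1_fun (\<lambda>x. w x + w' x) (\<lambda>x. h x + h' x)"
  by (auto simp: C1_fun_def intro: GDERIV_add continuous_on_add)

lemma C1_fun_diff: "C1_fun w h \<Longrightarrow> C1_fun w' h' \<Longrightarrow> C1_fun (\<lambda>x. w x - w' x) (\<lambda>x. h x - h' x)"
  by (auto simp: C1_fun_def intro: GDERIV_diff continuous_on_diff)

lemma C1_fun_mult:
  assumes "C1_fun w h" "C1_fun w' h'"
  shows "C1_fun (\<lambda>x. w x * w' x) (\<lambda>x. w x *\<^sub>R h' x + w' x *\<^sub>R h x)"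
  using assms C1_fun_continuous[OF assms(1), of UNIV] C1_fun_continuous[OF assms(2), of UNIV]
  by (auto simp: C1_fun_def intro!: GDERIV_mult continuous_intros)

lemma C1_fun_cmult: "C1_fun w h \<Longrightarrow> C1_fun (\<lambda>x. k * w x) (\<lambda>x. k *\<^sub>R h x)"
  using C1_fun_mult[OF C1_fun_const[of k], of w h] by simp

lemma C1_fun_compose:
  assumes "C1_fun w h" "\<And>t. (F has_real_derivative F' t) (at t)" "continuous_on UNIV F'"
  shows "C1_fun (\<lambda>x. F (w x)) (\<lambda>x. F' (w x) *\<^sub>R h x)"
  unfolding C1_fun_def
proof (intro conjI allI)
  show "GDERIV (\<lambda>x. F (w x)) x :> F' (w x) *\<^sub>R h x" for x
    using assms by (intro GDERIV_DERIV_compose) (auto simp: C1_fun_def)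
  show "continuous_on UNIV (\<lambda>x. F' (w x) *\<^sub>R h x)"
    using C1_fun_continuous[OF assms(1), of UNIV] assms(1)
    by (auto simp: C1_fun_def intro!: continuous_intros continuous_on_compose2[OF assms(3)])
qed

lemma C1_fun_prod_exists:
  assumes "finite A" "\<And>k. k \<in> A \<Longrightarrow> \<exists>h. C1_fun (w k) h"
  shows "\<exists>h. C1_fun (\<lambda>x. \<Prod>k\<in>A. w k x) h"
  using assms by (induction A rule: finite_induct) (use C1_fun_const C1_fun_mult in fastforce)+

lemma C1_fun_power_exists: "\<exists>h. C1_fun w h \<Longrightarrow> \<exists>h. C1_fun (\<lambda>x. w x ^ n) h"
  by (induction n) (use C1_fun_const C1_fun_mult in fastforce)+

lemma real_polynomial_function_C1: "real_polynomial_function p \<Longrightarrow> \<exists>h. C1_fun p h"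
proof (induction rule: real_polynomial_function.induct)
  case (linear f)
  define d where "d = (\<Sum>b\<in>Basis. f b *\<^sub>R b)"
  have "f = (\<lambda>x. x \<bullet> d)"
  proof
    fix x
    interpret f: bounded_linear f by fact
    have "f x = f (\<Sum>b\<in>Basis. (x \<bullet> b) *\<^sub>R b)" by (simp add: euclidean_representation)
    also have "\<dots> = (\<Sum>b\<in>Basis. (x \<bullet> b) * f b)" by (simp add: f.sum f.scaleR)
    finally show "f x = x \<bullet> d" by (simp add: d_def inner_sum_right mult.commute)
  qed
  moreover have "(f has_derivative f) (at x)" for x
    using linear by (rule bounded_linear_imp_has_derivative)
  ultimately have "GDERIV f x :> d" for x
    unfolding gderiv_def by metis
  then have "C1_fun f (\<lambda>x. d)"
    by (simp add: C1_fun_def)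
  then show ?case by blast
qed (use C1_fun_const C1_fun_add C1_fun_mult in blast)+

text \<open>
  The square makes the function \<open>C\<^sup>1\<close> across the sphere of radius \<open>r\<close>. The symmetry in \<open>c\<close> and \<open>x\<close> lets
  the same function serve as a cutoff, with \<open>c\<close> fixed, and as a mollifier, with \<open>x\<close> as the parameter.
\<close>

definition bump :: "'a::euclidean_space \<Rightarrow> real \<Rightarrow> 'a \<Rightarrow> real" where
  "bump c r x = (max 0 (r\<^sup>2 - (norm (x - c))\<^sup>2))\<^sup>2"

definition bump_grad :: "'a::euclidean_space \<Rightarrow> real \<Rightarrow> 'a \<Rightarrow> 'a" where
  "bump_grad c r x = (- 4 * max 0 (r\<^sup>2 - (norm (x - c))\<^sup>2)) *\<^sub>R (x - c)"

lemma DERIV_square_pos_part: "((\<lambda>t. (max 0 t)\<^sup>2) has_real_derivative 2 * max 0 t) (at (t::real))"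
proof -
  consider "t > 0" | "t < 0" | "t = 0" by linarith
  then show ?thesis
  proof cases
    case 1
    have "((\<lambda>t. t\<^sup>2) has_real_derivative 2 * max 0 t) (at t)"
      using 1 by (auto intro!: derivative_eq_intros)
    then show ?thesis
      by (rule has_field_derivative_transform_within_open[where S="{0<..}"]) (use 1 in auto)
  next
    case 2
    have "((\<lambda>t. 0) has_real_derivative 2 * max 0 t) (at t)" using 2 by simp
    then show ?thesis
      by (rule has_field_derivative_transform_within_open[where S="{..<0}"]) (use 2 in auto)
  next
    case 3
    have "((\<lambda>h. (max 0 h)\<^sup>2 / h) \<longlongrightarrow> 0) (at (0::real))"
    proof (rule tendsto_0_le[where K=1 and f="\<lambda>h. h"])
      show "\<forall>\<^sub>F x::real in at 0. norm ((max 0 x)\<^sup>2 / x) \<le> norm x * 1"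
        by (rule always_eventually) (auto simp: max_def power2_eq_square abs_mult)
    qed (rule tendsto_ident_at)
    then show ?thesis using 3 by (simp only: DERIV_def) simp
  qed
qed

lemma C1_fun_bump: "C1_fun (bump c r) (bump_grad c r)"
proof -
  have "GDERIV (\<lambda>x. r\<^sup>2 - (norm (x - c))\<^sup>2) x :> (- 2) *\<^sub>R (x - c)" for x
    unfolding gderiv_def power2_norm_eq_inner
    by (auto intro!: derivative_eq_intros simp: inner_commute inner_simps)
  then have "C1_fun (\<lambda>x. r\<^sup>2 - (norm (x - c))\<^sup>2) (\<lambda>x. (- 2) *\<^sub>R (x - c))"
    by (auto simp: C1_fun_def intro!: continuous_intros)
  from C1_fun_compose[OF this DERIV_square_pos_part] show ?thesis
    by (rule C1_fun_cong) (auto intro!: continuous_intros simp: bump_def bump_grad_def)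
qed

lemma bump_nonneg: "bump c r x \<ge> 0" by (simp add: bump_def)

lemma bump_le: "bump c r x \<le> r^4"
proof -
  have "max 0 (r\<^sup>2 - (norm (x - c))\<^sup>2) \<le> r\<^sup>2" by simp
  then have "(max 0 (r\<^sup>2 - (norm (x - c))\<^sup>2))\<^sup>2 \<le> (r\<^sup>2)\<^sup>2" by (intro power_mono) auto
  then show ?thesis by (simp add: bump_def flip: power_mult)
qed

lemma bump_pos: "r > 0 \<Longrightarrow> x \<in> ball c r \<Longrightarrow> bump c r x > 0"
  by (auto simp: bump_def dist_norm norm_minus_commute max_def intro: power_strict_mono)

lemma bump_outside: "r > 0 \<Longrightarrow> x \<notin> ball c r \<Longrightarrow> bump c r x = 0"
  by (auto simp: bump_def dist_norm norm_minus_commute max_def power_mono)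

lemma bump_grad_outside: "r > 0 \<Longrightarrow> x \<notin> ball c r \<Longrightarrow> bump_grad c r x = 0"
  by (auto simp: bump_grad_def dist_norm norm_minus_commute max_def power_mono)

lemma test_function_iff:
  "test_function \<Omega> \<phi> g \<longleftrightarrow> C1_fun \<phi> g \<and> (\<exists>S. compact S \<and> S \<subseteq> \<Omega> \<and> (\<forall>x. x \<notin> S \<longrightarrow> \<phi> x = 0))"
  by (auto simp: test_function_def C1_fun_def)

lemma test_function_C1: "test_function \<Omega> \<phi> g \<Longrightarrow> C1_fun \<phi> g"
  by (simp add: test_function_iff)

lemma test_function_bump: "r > 0 \<Longrightarrow> cball c r \<subseteq> \<Omega> \<Longrightarrow> test_function \<Omega> (bump c r) (bump_grad c r)"
  unfolding test_function_iff
  by (rule conjI[OF C1_fun_bump], rule exI[of _ "cball c r"]) (auto intro!: bump_outside)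

lemma test_function_mult:
  "C1_fun w h \<Longrightarrow> test_function \<Omega> \<phi> g \<Longrightarrow>
    test_function \<Omega> (\<lambda>x. w x * \<phi> x) (\<lambda>x. w x *\<^sub>R g x + \<phi> x *\<^sub>R h x)"
  unfolding test_function_iff by (auto intro!: C1_fun_mult)

lemma test_function_grad_outside:
  assumes "C1_fun \<phi> g" "compact S" "\<And>x. x \<notin> S \<Longrightarrow> \<phi> x = 0" "x \<notin> S"
  shows "g x = 0"
proof -
  have op: "open (- S)" using assms(2) by (simp add: compact_imp_closed open_Compl)
  have der: "(\<phi> has_derivative (\<lambda>h. h \<bullet> g x)) (at x)"
    using C1_fun_GDERIV[OF assms(1), of x] by (simp only: gderiv_def)
  have "((\<lambda>_. 0) has_derivative (\<lambda>h. h \<bullet> g x)) (at x)"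
    by (rule has_derivative_transform_within_open[OF der op]) (simp_all add: assms(3,4))
  then have "(\<lambda>h. h \<bullet> g x) = (\<lambda>h. 0)"
    by (rule has_derivative_unique) (rule has_derivative_const)
  then have "g x \<bullet> g x = 0" by (rule fun_cong)
  then show ?thesis by simp
qed

lemma C1_fun_lipschitz:
  assumes "C1_fun w h" "convex S" "\<And>x. x \<in> S \<Longrightarrow> norm (h x) \<le> L" "x \<in> S" "y \<in> S"
  shows "\<bar>w x - w y\<bar> \<le> L * norm (x - y)"
proof -
  have "norm (w x - w y) \<le> L * norm (x - y)"
  proof (rule differentiable_bound[OF assms(2) _ _ assms(4,5)])
    fix z assume z: "z \<in> S"
    show "(w has_derivative (\<lambda>v. v \<bullet> h z)) (at z within S)"
      using C1_fun_GDERIV[OF assms(1), of z] unfolding gderiv_def by (rule has_derivative_at_withinI)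
    show "onorm (\<lambda>v. v \<bullet> h z) \<le> L"
    proof (rule onorm_le)
      fix v show "norm (v \<bullet> h z) \<le> L * norm v"
        using Cauchy_Schwarz_ineq2[of v "h z"] mult_left_mono[OF assms(3)[OF z], of "norm v"]
        by (simp add: mult.commute)
    qed
  qed
  then show ?thesis by simp
qed

section \<open>Density of test functions\<close>

context bounded_open_set
begin

text \<open>
  Cover \<open>\<Omega>\<close> by countably many balls that carry bumps, scaled to take values in \<open>[0,1]\<close>. The product of
  the factors \<open>1 - bump\<close> over the first \<open>n\<close> balls is less than \<open>1\<close> exactly on their union; its
  \<open>n\<close>-th power tends to \<open>0\<close> there, so bumps positive on the balls suffice and none has to be
  equal to \<open>1\<close> anywhere.
\<close>

lemma cutoff_sequence:
  obtains \<zeta> h where "\<And>n::nat. test_function \<Omega> (\<zeta> n) (h n)" "\<And>n x. 0 \<le> \<zeta> n x" "\<And>n x. \<zeta> n x \<le> 1"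
    "\<And>x. x \<in> \<Omega> \<Longrightarrow> (\<lambda>n. \<zeta> n x) \<longlonglongrightarrow> 1"
proof -
  let ?F = "{ball c r | c r. r > 0 \<and> cball c r \<subseteq> \<Omega>}"
  obtain F' where F': "F' \<subseteq> ?F" "countable F'" "\<Union>F' = \<Union>?F"
    using Lindelof[of ?F] by auto
  have UF: "\<Union>?F = \<Omega>"
  proof
    show "\<Union>?F \<subseteq> \<Omega>" using ball_subset_cball by blast
    show "\<Omega> \<subseteq> \<Union>?F"
    proof
      fix x assume "x \<in> \<Omega>"
      then obtain r where "r > 0" "cball x r \<subseteq> \<Omega>" using open_dom open_contains_cball by blast
      then show "x \<in> \<Union>?F" using centre_in_ball by blast
    qed
  qed
  then have ne: "F' \<noteq> {}" using F'(3) nonempty_dom by auto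
  define B where "B = from_nat_into F'"
  have rB: "range B = F'" unfolding B_def using ne F'(2) by (rule range_from_nat_into)
  then have "\<exists>c r. B k = ball c r \<and> r > 0 \<and> cball c r \<subseteq> \<Omega>" for k using F'(1) by blast
  then obtain c r where cr: "\<And>k. B k = ball (c k) (r k)" "\<And>k. r k > 0" "\<And>k. cball (c k) (r k) \<subseteq> \<Omega>"
    by metis
  define \<eta> where "\<eta> k x = 1 - (1 / r k ^ 4) * bump (c k) (r k) x" for k x
  have \<eta>01: "0 \<le> \<eta> k x" "\<eta> k x \<le> 1" for k x
    using bump_le[of "c k" "r k" x] bump_nonneg[of "c k" "r k" x] cr(2)[of k] by (auto simp: \<eta>_def field_simps)
  have \<eta>C1: "\<exists>h. C1_fun (\<eta> k) h" for k
    unfolding \<eta>_def by (intro exI) (rule C1_fun_diff[OF C1_fun_const C1_fun_cmult[OF C1_fun_bump]])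
  define \<zeta> where "\<zeta> n x = 1 - (\<Prod>k<n. \<eta> k x ^ n)" for n x
  have "\<exists>h. C1_fun (\<lambda>x. \<Prod>k<n. \<eta> k x ^ n) h" for n
    by (rule C1_fun_prod_exists) (auto intro: C1_fun_power_exists[OF \<eta>C1])
  then have "\<exists>h. C1_fun (\<zeta> n) h" for n
    unfolding \<zeta>_def using C1_fun_diff[OF C1_fun_const] by blast
  then obtain h where h: "\<And>n. C1_fun (\<zeta> n) (h n)" by metis
  show ?thesis
  proof
    show "test_function \<Omega> (\<zeta> n) (h n)" for n
      unfolding test_function_iff
    proof (intro conjI exI)
      show "C1_fun (\<zeta> n) (h n)" by (rule h)
      show "compact (\<Union>k<n. cball (c k) (r k))" by (intro compact_UN) auto
      show "(\<Union>k<n. cball (c k) (r k)) \<subseteq> \<Omega>" using cr(3) by blast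
      show "\<forall>x. x \<notin> (\<Union>k<n. cball (c k) (r k)) \<longrightarrow> \<zeta> n x = 0"
      proof (intro allI impI)
        fix x assume "x \<notin> (\<Union>k<n. cball (c k) (r k))"
        then have "bump (c k) (r k) x = 0" if "k < n" for k
          using that by (intro bump_outside[OF cr(2)]) (auto dest: less_imp_le)
        then have "(\<Prod>k<n. \<eta> k x ^ n) = (\<Prod>k<n. 1)" by (intro prod.cong) (auto simp: \<eta>_def)
        then show "\<zeta> n x = 0" by (simp add: \<zeta>_def)
      qed
    qed
    have p01: "0 \<le> (\<Prod>k<n. \<eta> k x ^ n)" "(\<Prod>k<n. \<eta> k x ^ n) \<le> 1" for n x
      by (auto intro!: prod_nonneg prod_le_1 zero_le_power power_le_one \<eta>01)
    show "0 \<le> \<zeta> n x" "\<zeta> n x \<le> 1" for n x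
      using p01[of x n] by (auto simp: \<zeta>_def)
    fix x assume "x \<in> \<Omega>"
    then have "x \<in> \<Union>(range B)" using UF F'(3) rB by simp
    then obtain k where k: "x \<in> ball (c k) (r k)" using cr(1) by auto
    then have "\<eta> k x < 1" using bump_pos[OF cr(2) k] cr(2)[of k] by (auto simp: \<eta>_def)
    then have lim: "(\<lambda>n. \<eta> k x ^ n) \<longlonglongrightarrow> 0" using \<eta>01 by (intro LIMSEQ_power_zero) auto
    have "(\<lambda>n. \<Prod>k<n. \<eta> k x ^ n) \<longlonglongrightarrow> 0"
    proof (rule tendsto_sandwich[OF _ _ tendsto_const lim])
      show "\<forall>\<^sub>F n in sequentially. 0 \<le> (\<Prod>k<n. \<eta> k x ^ n)" using p01 by simp
      show "\<forall>\<^sub>F n in sequentially. (\<Prod>k<n. \<eta> k x ^ n) \<le> \<eta> k x ^ n"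
        using eventually_gt_at_top[of k]
      proof eventually_elim
        case (elim n)
        have "(\<Prod>j<n. \<eta> j x ^ n) = \<eta> k x ^ n * (\<Prod>j\<in>{..<n} - {k}. \<eta> j x ^ n)"
          using elim by (intro prod.remove) auto
        also have "\<dots> \<le> \<eta> k x ^ n * 1"
          by (intro mult_left_mono prod_le_1) (auto intro: zero_le_power power_le_one \<eta>01)
        finally show ?case by simp
      qed
    qed
    then have "(\<lambda>n. 1 - (\<Prod>k<n. \<eta> k x ^ n)) \<longlonglongrightarrow> 1 - 0" by (intro tendsto_diff tendsto_const)
    then show "(\<lambda>n. \<zeta> n x) \<longlonglongrightarrow> 1" by (simp add: \<zeta>_def)
  qed
qed

text \<open>
  A measurable function is almost everywhere a limit of continuous functions. These may be clamped to
  the bound of \<open>F\<close>, replaced by polynomials on the compact closure of \<open>\<Omega>\<close> (Stone-Weierstrass),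
  which are \<open>C\<^sup>1\<close>, and multiplied by the cutoffs.
\<close>

lemma test_functions_dense:
  assumes "F \<in> Linf \<Omega>"
  obtains \<psi> g C where "\<And>n::nat. test_function \<Omega> (\<psi> n) (g n)" "\<And>n x. \<bar>\<psi> n x\<bar> \<le> C"
    "AE x in \<mu>. (\<lambda>n. \<psi> n x) \<longlonglongrightarrow> (F x :: real)"
proof -
  obtain C where C: "C \<ge> 0" "AE x in \<mu>. norm (F x) \<le> C" using assms by (rule Linf_boundE)
  have "F measurable_on \<Omega>"
    using Linf_measurable[OF assms] measurable_on_iff_borel_measurable[OF dom_lebesgue] by blast
  then obtain N f where N: "negligible N" and f: "\<And>n. continuous_on UNIV (f n)"
    and lim: "\<And>x. x \<notin> N \<Longrightarrow> (\<lambda>n. f n x) \<longlonglongrightarrow> (if x \<in> \<Omega> then F x else 0)"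
    unfolding measurable_on_def by blast
  define k where "k n x = max (- C) (min C (f n x))" for n x
  have "\<exists>p. real_polynomial_function p \<and> (\<forall>x\<in>closure \<Omega>. \<bar>k n x - p x\<bar> < 1 / Suc n)" for n
  proof -
    have "continuous_on (closure \<Omega>) (k n)"
      unfolding k_def by (intro continuous_intros continuous_on_subset[OF f]) auto
    moreover have "compact (closure \<Omega>)" using bounded_dom by (simp add: compact_closure)
    moreover have "0 < 1 / real (Suc n)" by simp
    ultimately obtain p where "real_polynomial_function p" "\<And>x. x \<in> closure \<Omega> \<Longrightarrow> \<bar>k n x - p x\<bar> < 1 / Suc n"
      by (metis Stone_Weierstrass_real_polynomial_function)
    then show ?thesis by blast
  qed
  then have "\<forall>n. \<exists>p. real_polynomial_function p \<and> (\<forall>x\<in>closure \<Omega>. \<bar>k n x - p x\<bar> < 1 / Suc n)" by blast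
  from choice[OF this] obtain p where p: "\<And>n. real_polynomial_function (p n)"
    "\<And>n x. x \<in> closure \<Omega> \<Longrightarrow> \<bar>k n x - p n x\<bar> < 1 / Suc n" by blast
  obtain q where q: "\<And>n. C1_fun (p n) (q n)" using real_polynomial_function_C1[OF p(1)] by metis
  obtain \<zeta> h where \<zeta>: "\<And>n::nat. test_function \<Omega> (\<zeta> n) (h n)" "\<And>n x. 0 \<le> \<zeta> n x" "\<And>n x. \<zeta> n x \<le> 1"
    "\<And>x. x \<in> \<Omega> \<Longrightarrow> (\<lambda>n. \<zeta> n x) \<longlonglongrightarrow> 1" by (rule cutoff_sequence) blast
  show ?thesis
  proof
    show "test_function \<Omega> (\<lambda>x. p n x * \<zeta> n x) (\<lambda>x. p n x *\<^sub>R h n x + \<zeta> n x *\<^sub>R q n x)" for n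
      by (rule test_function_mult[OF q \<zeta>(1)])
    show "\<bar>p n x * \<zeta> n x\<bar> \<le> C + 1" for n x
    proof (cases "x \<in> \<Omega>")
      case True
      then have "x \<in> closure \<Omega>" using closure_subset by blast
      then have "\<bar>k n x - p n x\<bar> < 1 / Suc n" by (rule p(2))
      moreover have "1 / Suc n \<le> (1::real)" by simp
      moreover have "\<bar>k n x\<bar> \<le> C" using C(1) by (auto simp: k_def)
      ultimately have "\<bar>p n x\<bar> \<le> C + 1" by linarith
      then have "\<bar>p n x\<bar> * \<bar>\<zeta> n x\<bar> \<le> (C + 1) * 1"
        using \<zeta>(2,3)[of n x] C(1) by (intro mult_mono) auto
      then show ?thesis by (simp add: abs_mult)
    next
      case False
      then have "\<zeta> n x = 0" using \<zeta>(1)[of n] by (auto simp: test_function_iff)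
      then show ?thesis using C(1) by simp
    qed
    have "N \<in> null_sets lebesgue" using N by (simp add: negligible_iff_null_sets)
    then have "AE x in lebesgue. x \<notin> N" by (rule AE_not_in)
    then have "AE x in \<mu>. x \<notin> N" using dom_lebesgue by (auto simp: AE_restrict_space_iff)
    moreover have "AE x in \<mu>. x \<in> \<Omega>" by (rule AE_domI)
    ultimately show "AE x in \<mu>. (\<lambda>n. p n x * \<zeta> n x) \<longlonglongrightarrow> F x" using C(2)
    proof eventually_elim
      case (elim x)
      then have "(\<lambda>n. f n x) \<longlonglongrightarrow> F x" using lim[of x] by simp
      then have "(\<lambda>n. k n x) \<longlonglongrightarrow> max (- C) (min C (F x))"
        unfolding k_def by (intro tendsto_max tendsto_min tendsto_const)
      then have kF: "(\<lambda>n. k n x) \<longlonglongrightarrow> F x" using elim(3) by (simp add: max_def min_def abs_le_iff split: if_splits)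
      have xc: "x \<in> closure \<Omega>" using elim closure_subset by blast
      have "(\<lambda>n. p n x - k n x) \<longlonglongrightarrow> 0"
      proof (rule tendsto_0_le[where K=1 and f="\<lambda>n. 1 / real (Suc n)"])
        show "(\<lambda>n. 1 / real (Suc n)) \<longlonglongrightarrow> 0" by (rule LIMSEQ_Suc[OF lim_1_over_n])
        show "\<forall>\<^sub>F n in sequentially. norm (p n x - k n x) \<le> norm (1 / real (Suc n)) * 1"
          using p(2)[OF xc] by (intro always_eventually allI) (simp add: abs_minus_commute less_imp_le)
      qed
      then have "(\<lambda>n. p n x) \<longlonglongrightarrow> F x" using tendsto_add[OF _ kF, of "\<lambda>n. p n x - k n x" 0] by simp
      from tendsto_mult[OF this \<zeta>(4)] elim show ?case by simp
    qed
  qed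
qed

lemma test_function_Linf:
  assumes "test_function \<Omega> \<phi> g" shows "\<phi> \<in> Linf \<Omega>" "g \<in> Linf \<Omega>"
  using C1_fun_continuous[OF test_function_C1[OF assms]] C1_fun_continuous_grad[OF test_function_C1[OF assms]]
  by (auto intro: Linf_continuous)

text \<open>
  Test functions that approximate \<open>F\<close> boundedly almost everywhere may be inserted for \<open>\<phi>\<close>; in the
  limit the integral of \<open>F^2\<close> vanishes.
\<close>

lemma fundamental_lemma:
  assumes F: "(F::'a \<Rightarrow> real) \<in> Linf \<Omega>"
    and 0: "\<And>\<phi> g. test_function \<Omega> \<phi> g \<Longrightarrow> (LINT x|\<mu>. F x * \<phi> x) = 0"
  shows "AE x in \<mu>. F x = 0"
proof -
  obtain \<psi> g C where \<psi>: "\<And>n::nat. test_function \<Omega> (\<psi> n) (g n)" "\<And>n x. \<bar>\<psi> n x\<bar> \<le> C"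
    "AE x in \<mu>. (\<lambda>n. \<psi> n x) \<longlonglongrightarrow> F x" using F by (rule test_functions_dense) blast
  obtain A where A: "A \<ge> 0" "AE x in \<mu>. norm (F x) \<le> A" using F by (rule Linf_boundE)
  have "(\<lambda>n. LINT x|\<mu>. F x * \<psi> n x) \<longlonglongrightarrow> (LINT x|\<mu>. F x * F x)"
  proof (rule integral_bounded_convergence[where C="A * C"])
    show "AE x in \<mu>. (\<lambda>n. F x * \<psi> n x) \<longlonglongrightarrow> F x * F x"
      using \<psi>(3) by eventually_elim (intro tendsto_mult tendsto_const)
    show "AE x in \<mu>. \<bar>F x * \<psi> n x\<bar> \<le> A * C" for n
      using A(2) by eventually_elim (use A(1) \<psi>(2) in \<open>auto simp: abs_mult intro!: mult_mono\<close>)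
  qed (use test_function_Linf[OF \<psi>(1)] F in \<open>auto intro!: Linf_measurable Linf_mult\<close>)
  then have "(LINT x|\<mu>. F x * F x) = 0" using 0[OF \<psi>(1)] by (simp add: LIMSEQ_const_iff)
  then have "AE x in \<mu>. F x * F x = 0"
    using integral_nonneg_eq_0_iff_AE[OF Linf_integrable[OF Linf_mult[OF F F]]] by simp
  then show ?thesis by simp
qed

lemma ball_not_AE:
  assumes "ball c r \<subseteq> \<Omega>" "r > 0" "AE x in \<mu>. P x"
  shows "\<exists>x\<in>ball c r. P x"
proof (rule ccontr)
  assume neg: "\<not> (\<exists>x\<in>ball c r. P x)"
  have "AE x in lebesgue. x \<in> \<Omega> \<longrightarrow> P x"
    using assms(3) dom_lebesgue by (simp add: AE_restrict_space_iff)
  then have "AE x in lebesgue. x \<notin> ball c r"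
    by eventually_elim (use neg assms(1) in blast)
  then have "ball c r \<in> null_sets lebesgue" by (subst AE_iff_null_sets) auto
  then have "negligible (ball c r)" by (simp add: negligible_iff_null_sets)
  then show False using assms(2) open_not_negligible[of "ball c r"] by simp
qed

lemma integral_pos_on_ball:
  fixes f :: "'a \<Rightarrow> real"
  assumes "f \<in> Linf \<Omega>" "\<And>x. x \<in> \<Omega> \<Longrightarrow> f x \<ge> 0"
    and "ball c r \<subseteq> \<Omega>" "r > 0" "\<And>x. x \<in> ball c r \<Longrightarrow> f x > 0"
  shows "(LINT x|\<mu>. f x) > 0"
proof -
  have nn: "AE x in \<mu>. 0 \<le> f x" using assms(2) by (rule AE_domI)
  have "(LINT x|\<mu>. f x) \<noteq> 0"
  proof
    assume "(LINT x|\<mu>. f x) = 0"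
    then have "AE x in \<mu>. f x = 0"
      using integral_nonneg_eq_0_iff_AE[OF Linf_integrable[OF assms(1)] nn] by simp
    then show False using ball_not_AE[OF assms(3,4)] assms(5) by force
  qed
  moreover have "(LINT x|\<mu>. f x) \<ge> 0" using nn by (rule integral_nonneg_AE)
  ultimately show ?thesis by simp
qed

section \<open>Weak gradients\<close>

lemma integral_translation_lborel:
  fixes f :: "'a \<Rightarrow> real"
  assumes "f \<in> borel_measurable borel"
  shows "(LINT x|lborel. f (x + h)) = (LINT x|lborel. f x)"
proof -
  have "(LINT x|lborel. f x) = (LINT x|distr lborel borel ((+) h). f x)" by (simp add: lborel_distr_plus)
  also have "\<dots> = (LINT x|lborel. f (h + x))" using assms by (subst integral_distr) auto
  finally show ?thesis by (simp add: add.commute)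
qed

lemma integral_supported:
  fixes f :: "'a \<Rightarrow> real"
  assumes "f \<in> borel_measurable borel" "\<And>x. x \<notin> \<Omega> \<Longrightarrow> f x = 0"
  shows "(LINT x|\<mu>. f x) = (LINT x|lborel. f x)"
proof -
  have "(LINT x|\<mu>. f x) = (LINT x|lebesgue. indicator \<Omega> x *\<^sub>R f x)"
    using dom_lebesgue by (intro integral_restrict_space) simp
  also have "\<dots> = (LINT x|lebesgue. f x)"
    using assms(2) by (intro Bochner_Integration.integral_cong) (auto simp: indicator_def)
  also have "\<dots> = (LINT x|lborel. f x)" using assms(1) by (intro integral_completion) simp
  finally show ?thesis .
qed

text \<open>
  The integral of a difference quotient of \<open>\<phi>\<close> vanishes by translation invariance, and the
  difference quotients converge to the directional derivative, dominated by the Lipschitz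
  constant on a fixed ball.
\<close>

lemma integral_test_function_deriv:
  assumes "test_function \<Omega> \<phi> g" and b: "norm b \<le> 1"
  shows "(LINT x|\<mu>. g x \<bullet> b) = 0"
proof -
  obtain S where S: "compact S" "S \<subseteq> \<Omega>" "\<And>x. x \<notin> S \<Longrightarrow> \<phi> x = 0" and C1: "C1_fun \<phi> g"
    using assms(1) by (auto simp: test_function_iff)
  have g0: "x \<notin> S \<Longrightarrow> g x = 0" for x using C1 S(1,3) by (rule test_function_grad_outside)
  have "bounded (g ` S)"
    using S(1) C1_fun_continuous_grad[OF C1] by (intro compact_imp_bounded compact_continuous_image)
  then obtain L where "\<forall>y\<in>g ` S. norm y \<le> L" unfolding bounded_iff by blast
  then have L: "norm (g x) \<le> max 0 L" for x
    by (cases "x \<in> S") (force simp: g0)+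
  obtain R where "\<forall>x\<in>S. norm x \<le> R" using compact_imp_bounded[OF S(1)] unfolding bounded_iff by blast
  then have R: "S \<subseteq> cball 0 R" by auto
  have \<phi>m [measurable]: "\<phi> \<in> borel_measurable borel"
    using C1_fun_continuous[OF C1] by (rule borel_measurable_continuous_onI)
  have gm [measurable]: "g \<in> borel_measurable borel"
    using C1_fun_continuous_grad[OF C1] by (rule borel_measurable_continuous_onI)
  define D where "D n x = real (Suc n) * (\<phi> (x + (1 / Suc n) *\<^sub>R b) - \<phi> x)" for n x
  have int\<phi>: "integrable lborel \<phi>"
  proof -
    have "integrable lborel (\<lambda>x. indicator S x *\<^sub>R \<phi> x)"
      using borel_integrable_compact[OF S(1) C1_fun_continuous[OF C1]] by simp
    then show ?thesis
      by (rule Bochner_Integration.integrable_cong[THEN iffD1, rotated 2]) (auto simp: S(3) indicator_def)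
  qed
  have int\<phi>h: "integrable lborel (\<lambda>x. \<phi> (x + v))" for v
  proof -
    have "integrable (distr lborel borel ((+) v)) \<phi>" using int\<phi> by (simp add: lborel_distr_plus)
    then show ?thesis by (subst (asm) integrable_distr_eq) (auto simp: add.commute)
  qed
  have D0: "(LINT x|lborel. D n x) = 0" for n
    unfolding D_def using int\<phi> int\<phi>h by (simp add: integral_translation_lborel)
  have "(\<lambda>n. LINT x|lborel. D n x) \<longlonglongrightarrow> (LINT x|lborel. g x \<bullet> b)"
  proof (rule integral_dominated_convergence[where w="\<lambda>x. max 0 L * indicator (cball 0 (R + 1)) x"])
    show "integrable lborel (\<lambda>x. max 0 L * indicator (cball 0 (R + 1)) x :: real)"
      using emeasure_compact_finite[of "cball 0 (R + 1)"] by auto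
    show "AE x in lborel. (\<lambda>n. D n x) \<longlonglongrightarrow> g x \<bullet> b"
    proof (rule AE_I2)
      fix x
      have "((\<lambda>t. \<phi> (x + t *\<^sub>R b)) has_derivative (\<lambda>t. (t *\<^sub>R b) \<bullet> g x)) (at 0)"
      proof (rule has_derivative_compose[where g=\<phi>])
        show "((\<lambda>t. x + t *\<^sub>R b) has_derivative (\<lambda>t. t *\<^sub>R b)) (at 0)"
          by (auto intro!: derivative_eq_intros)
        show "(\<phi> has_derivative (\<lambda>v. v \<bullet> g x)) (at (x + 0 *\<^sub>R b))"
          using C1_fun_GDERIV[OF C1, of x] by (simp add: gderiv_def)
      qed
      then have "((\<lambda>t. \<phi> (x + t *\<^sub>R b)) has_real_derivative (b \<bullet> g x)) (at 0)"
        by (simp add: has_field_derivative_def mult.commute[of "b \<bullet> g x"] ac_simps mult_commute_abs)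
      then have lim: "((\<lambda>t. (\<phi> (x + t *\<^sub>R b) - \<phi> x) / t) \<longlongrightarrow> b \<bullet> g x) (at 0)"
        by (simp add: DERIV_def)
      have "filterlim (\<lambda>n. 1 / real (Suc n)) (at 0) sequentially"
        using LIMSEQ_Suc[OF lim_1_over_n[where 'a=real]] by (simp add: filterlim_at)
      from filterlim_compose[OF lim this]
      have "(\<lambda>n. (\<phi> (x + (1 / real (Suc n)) *\<^sub>R b) - \<phi> x) / (1 / real (Suc n))) \<longlonglongrightarrow> b \<bullet> g x" .
      then show "(\<lambda>n. D n x) \<longlonglongrightarrow> g x \<bullet> b"
        by (simp add: D_def inner_commute mult.commute)
    qed
    show "AE x in lborel. norm (D n x) \<le> max 0 L * indicator (cball 0 (R + 1)) x" for n
    proof (rule AE_I2)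
      fix x
      let ?h = "(1 / real (Suc n)) *\<^sub>R b"
      have h1: "norm ?h \<le> 1 / Suc n" using b by (simp add: divide_right_mono)
      show "norm (D n x) \<le> max 0 L * indicator (cball 0 (R + 1)) x"
      proof (cases "x \<in> cball 0 (R + 1)")
        case True
        have "\<bar>\<phi> (x + ?h) - \<phi> x\<bar> \<le> max 0 L * norm (x + ?h - x)"
          by (rule C1_fun_lipschitz[OF C1 convex_UNIV L]) auto
        also have "\<dots> \<le> max 0 L * (1 / Suc n)"
          using h1 by (intro mult_left_mono) auto
        finally have "real (Suc n) * \<bar>\<phi> (x + ?h) - \<phi> x\<bar> \<le> real (Suc n) * (max 0 L * (1 / Suc n))"
          by (rule mult_left_mono) simp
        then show ?thesis using True by (simp add: D_def abs_mult del: of_nat_Suc)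
      next
        case False
        then have "norm x > R + 1" by simp
        moreover have "norm x \<le> norm (x + ?h) + norm ?h"
          using norm_triangle_ineq4[of "x + ?h" ?h] by simp
        moreover have "1 / real (Suc n) \<le> 1" by simp
        ultimately have "norm (x + ?h) > R" using h1 by linarith
        then have "x + ?h \<notin> S" "x \<notin> S" using R \<open>norm x > R + 1\<close> by force+
        then show ?thesis using False by (simp add: D_def S(3))
      qed
    qed
  qed (simp_all add: D_def)
  then have "(LINT x|lborel. g x \<bullet> b) = 0" by (simp add: D0 LIMSEQ_const_iff)
  moreover have "(LINT x|\<mu>. g x \<bullet> b) = (LINT x|lborel. g x \<bullet> b)"
  proof (rule integral_supported)
    show "g x \<bullet> b = 0" if "x \<notin> \<Omega>" for x
      using g0[of x] S(2) that by (simp add: subset_iff) force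
  qed simp
  ultimately show ?thesis by simp
qed

lemma C1_has_weak_gradient:
  assumes C1: "C1_fun w h" shows "has_weak_gradient \<Omega> w h"
  unfolding has_weak_gradient_def
proof (intro allI impI ballI)
  fix \<phi> g and b :: 'a assume t: "test_function \<Omega> \<phi> g" and b: "b \<in> Basis"
  note L = test_function_Linf[OF t] Linf_continuous[OF C1_fun_continuous[OF C1]]
    Linf_continuous[OF C1_fun_continuous_grad[OF C1]]
  have "(LINT x|\<mu>. (w x *\<^sub>R g x + \<phi> x *\<^sub>R h x) \<bullet> b) = 0"
    using b by (intro integral_test_function_deriv[OF test_function_mult[OF C1 t]]) simp
  moreover have "(LINT x|\<mu>. (w x *\<^sub>R g x + \<phi> x *\<^sub>R h x) \<bullet> b) =
      (LINT x|\<mu>. w x * (g x \<bullet> b)) + (LINT x|\<mu>. (h x \<bullet> b) * \<phi> x)"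
    using L by (subst Bochner_Integration.integral_add[symmetric])
       (auto intro!: Linf_integrable Linf_mult Linf_inner simp: inner_simps mult.commute)
  ultimately show "(LINT x|\<mu>. w x * (g x \<bullet> b)) = - (LINT x|\<mu>. (h x \<bullet> b) * \<phi> x)" by simp
qed

lemma has_weak_gradientD:
  "has_weak_gradient \<Omega> u G \<Longrightarrow> test_function \<Omega> \<phi> g \<Longrightarrow> b \<in> Basis \<Longrightarrow>
    (LINT x|\<mu>. u x * (g x \<bullet> b)) = - (LINT x|\<mu>. (G x \<bullet> b) * \<phi> x)"
  by (auto simp: has_weak_gradient_def)

lemma weak_gradient_unique:
  assumes "G \<in> Linf \<Omega>" "G' \<in> Linf \<Omega>" "has_weak_gradient \<Omega> u G" "has_weak_gradient \<Omega> u G'"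
  shows "AE x in \<mu>. G x = G' x"
proof -
  have "AE x in \<mu>. G x \<bullet> b - G' x \<bullet> b = 0" if b: "b \<in> Basis" for b
  proof (rule fundamental_lemma)
    show "(\<lambda>x. G x \<bullet> b - G' x \<bullet> b) \<in> Linf \<Omega>"
      using assms by (intro Linf_diff Linf_inner Linf_const)
    fix \<phi> g assume t: "test_function \<Omega> \<phi> g"
    have "(LINT x|\<mu>. (G x \<bullet> b) * \<phi> x) = (LINT x|\<mu>. (G' x \<bullet> b) * \<phi> x)"
      using has_weak_gradientD[OF assms(3) t b] has_weak_gradientD[OF assms(4) t b] by simp
    then show "(LINT x|\<mu>. (G x \<bullet> b - G' x \<bullet> b) * \<phi> x) = 0"
      using assms test_function_Linf[OF t]
      by (simp add: left_diff_distrib Bochner_Integration.integral_diff Linf_integrable Linf_mult Linf_inner)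
  qed
  then have "AE x in \<mu>. \<forall>b\<in>Basis. G x \<bullet> b - G' x \<bullet> b = 0"
    by (intro AE_ball_countable'  countable_finite finite_Basis)
  then show ?thesis by eventually_elim (auto intro: euclidean_eqI)
qed

lemma weak_grad_spec:
  assumes "u \<in> W1inf \<Omega>"
  shows "weak_grad \<Omega> u \<in> Linf \<Omega>" "has_weak_gradient \<Omega> u (weak_grad \<Omega> u)"
proof -
  have "\<exists>G. G \<in> Linf \<Omega> \<and> has_weak_gradient \<Omega> u G" using assms by (auto simp: W1inf_def)
  from someI_ex[OF this] show "weak_grad \<Omega> u \<in> Linf \<Omega>" "has_weak_gradient \<Omega> u (weak_grad \<Omega> u)"
    by (auto simp: weak_grad_def)
qed

lemma weak_grad_eq:
  assumes "u \<in> Linf \<Omega>" "G \<in> Linf \<Omega>" "has_weak_gradient \<Omega> u G"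
  shows "u \<in> W1inf \<Omega>" "AE x in \<mu>. weak_grad \<Omega> u x = G x"
proof -
  show "u \<in> W1inf \<Omega>" using assms by (auto simp: W1inf_def)
  from weak_gradient_unique[OF weak_grad_spec(1)[OF this] assms(2) weak_grad_spec(2)[OF this] assms(3)]
  show "AE x in \<mu>. weak_grad \<Omega> u x = G x" .
qed

text \<open>
  The gradient in the definition of \<open>K_set\<close> is chosen by Hilbert's operator; uniqueness of weak gradients lets
  any weak gradient \<open>G\<close> be used in its place.
\<close>

lemma K_setI:
  assumes "continuous_on (closure \<Omega>) u" "has_weak_gradient \<Omega> u G" "G \<in> borel_measurable \<mu>"
    "AE x in \<mu>. norm (G x) \<le> 1"
  shows "u \<in> K_set \<Omega>" "AE x in \<mu>. weak_grad \<Omega> u x = G x"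
proof -
  have G: "G \<in> Linf \<Omega>" using assms(3,4) by (rule Linf_I)
  note w = weak_grad_eq[OF Linf_continuous[OF assms(1)] G assms(2)]
  show AE: "AE x in \<mu>. weak_grad \<Omega> u x = G x" by (rule w)
  have "AE x in \<mu>. ereal (norm (weak_grad \<Omega> u x)) \<le> 1"
    using AE assms(4) by eventually_elim simp
  moreover have "(\<lambda>x. ereal (norm (weak_grad \<Omega> u x))) \<in> borel_measurable \<mu>"
    using weak_grad_spec(1)[OF w(1)] by (auto simp: Linf_iff)
  ultimately have "Linf_norm \<Omega> (weak_grad \<Omega> u) \<le> 1" unfolding Linf_norm_def by (rule esssup_I[rotated])
  then show "u \<in> K_set \<Omega>" using w(1) assms(1) by (simp add: K_set_def C_closure_def)
qed

lemma K_setD: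
  assumes "u \<in> K_set \<Omega>"
  shows "continuous_on (closure \<Omega>) u" "weak_grad \<Omega> u \<in> Linf \<Omega>"
    "has_weak_gradient \<Omega> u (weak_grad \<Omega> u)" "AE x in \<mu>. norm (weak_grad \<Omega> u x) \<le> 1"
proof -
  have "u \<in> W1inf \<Omega>" using assms by (simp add: K_set_def)
  then show "weak_grad \<Omega> u \<in> Linf \<Omega>" "has_weak_gradient \<Omega> u (weak_grad \<Omega> u)"
    by (rule weak_grad_spec)+
  show "continuous_on (closure \<Omega>) u" using assms by (simp add: K_set_def C_closure_def)
  have "esssup \<mu> (\<lambda>x. ereal (norm (weak_grad \<Omega> u x))) \<le> 1"
    using assms by (simp add: K_set_def Linf_norm_def)
  with esssup_AE[of "\<lambda>x. ereal (norm (weak_grad \<Omega> u x))" \<mu>]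
  show "AE x in \<mu>. norm (weak_grad \<Omega> u x) \<le> 1"
    by (auto elim!: eventually_mono dest: order_trans)
qed

text \<open>
  Hoelder's inequality for the exponents \<open>\<infinity>\<close> and \<open>1\<close>.
\<close>

lemma integral_mult_bound:
  fixes H D :: "'a \<Rightarrow> real"
  assumes "H \<in> Linf \<Omega>" "D \<in> Linf \<Omega>" "AE x in \<mu>. \<bar>H x\<bar> \<le> L"
  shows "\<bar>LINT x|\<mu>. H x * D x\<bar> \<le> L * (LINT x|\<mu>. \<bar>D x\<bar>)"
proof -
  have D: "(\<lambda>x. \<bar>D x\<bar>) \<in> Linf \<Omega>" using assms(2) by (rule Linf_compose) (intro continuous_intros)
  have HD: "(\<lambda>x. \<bar>H x * D x\<bar>) \<in> Linf \<Omega>"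
    using Linf_mult[OF assms(1,2)] by (rule Linf_compose) (intro continuous_intros)
  have "\<bar>LINT x|\<mu>. H x * D x\<bar> \<le> (LINT x|\<mu>. \<bar>H x * D x\<bar>)" by (rule integral_abs_bound)
  also have "\<dots> \<le> (LINT x|\<mu>. L * \<bar>D x\<bar>)"
  proof (rule integral_mono_AE)
    show "AE x in \<mu>. \<bar>H x * D x\<bar> \<le> L * \<bar>D x\<bar>"
      using assms(3) by eventually_elim (auto simp: abs_mult intro: mult_right_mono)
  qed (use D HD in \<open>auto intro!: Linf_integrable Linf_mult\<close>)
  finally show ?thesis by simp
qed

text \<open>
  Weak convergence of gradients. Against a test function this is integration by parts and the uniform
  convergence of \<open>w n\<close>; a general bounded \<open>F\<close> is approximated by test functions in the mean, and the common bound
  \<open>L\<close> makes the resulting error uniform in \<open>n\<close>.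
\<close>

lemma weak_gradient_limit:
  assumes hn: "\<And>n::nat. has_weak_gradient \<Omega> (w n) (G n)" and wn: "\<And>n. w n \<in> Linf \<Omega>"
    and Gn: "\<And>n. G n \<in> borel_measurable \<mu>" "\<And>n. AE x in \<mu>. norm (G n x) \<le> L"
    and hu: "has_weak_gradient \<Omega> u G'" and u: "u \<in> Linf \<Omega>" and G': "G' \<in> Linf \<Omega>"
    and close: "\<And>n x. x \<in> \<Omega> \<Longrightarrow> \<bar>w n x - u x\<bar> \<le> e n" and e: "e \<longlonglongrightarrow> 0"
    and F: "(F::'a \<Rightarrow> real) \<in> Linf \<Omega>" and b: "b \<in> Basis"
  shows "(\<lambda>n. LINT x|\<mu>. (G n x \<bullet> b) * F x) \<longlonglongrightarrow> (LINT x|\<mu>. (G' x \<bullet> b) * F x)"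
proof -
  have GnL: "G n \<in> Linf \<Omega>" for n using Gn by (rule Linf_I)
  have GnbL: "(\<lambda>x. G n x \<bullet> b) \<in> Linf \<Omega>" "(\<lambda>x. G' x \<bullet> b) \<in> Linf \<Omega>" for n
    using GnL G' by (auto intro: Linf_inner)
  obtain L' where L': "L' \<ge> 0" "AE x in \<mu>. norm (G' x) \<le> L'" using G' by (rule Linf_boundE)
  have bound: "AE x in \<mu>. \<bar>G n x \<bullet> b\<bar> \<le> L" for n
    using Gn(2)[of n] by eventually_elim (rule order_trans[OF Basis_le_norm[OF b]])
  have bound': "AE x in \<mu>. \<bar>G' x \<bullet> b\<bar> \<le> L'"
    using L'(2) by eventually_elim (rule order_trans[OF Basis_le_norm[OF b]])
  have test: "(\<lambda>n. LINT x|\<mu>. (G n x \<bullet> b) * \<psi> x) \<longlonglongrightarrow> (LINT x|\<mu>. (G' x \<bullet> b) * \<psi> x)"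
    if t: "test_function \<Omega> \<psi> g" for \<psi> g
  proof -
    note tL = test_function_Linf[OF t]
    have gb: "(\<lambda>x. g x \<bullet> b) \<in> Linf \<Omega>" using tL by (auto intro: Linf_inner)
    have "(\<lambda>n. LINT x|\<mu>. w n x * (g x \<bullet> b)) \<longlonglongrightarrow> (LINT x|\<mu>. u x * (g x \<bullet> b))"
    proof (rule Lim_transform_bound[where g="\<lambda>n. e n * (LINT x|\<mu>. \<bar>g x \<bullet> b\<bar>)", THEN LIM_zero_cancel])
      show "(\<lambda>n. e n * (LINT x|\<mu>. \<bar>g x \<bullet> b\<bar>)) \<longlonglongrightarrow> 0" using tendsto_mult_left_zero[OF e] .
      show "\<forall>\<^sub>F n in sequentially. norm ((LINT x|\<mu>. w n x * (g x \<bullet> b)) - (LINT x|\<mu>. u x * (g x \<bullet> b)))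
          \<le> norm (e n * (LINT x|\<mu>. \<bar>g x \<bullet> b\<bar>))"
      proof (rule always_eventually, rule allI)
        fix n
        have "(LINT x|\<mu>. w n x * (g x \<bullet> b)) - (LINT x|\<mu>. u x * (g x \<bullet> b)) =
            (LINT x|\<mu>. (w n x - u x) * (g x \<bullet> b))"
          using wn[of n] u gb
          by (simp add: left_diff_distrib Bochner_Integration.integral_diff Linf_integrable Linf_mult)
        also have "\<bar>\<dots>\<bar> \<le> e n * (LINT x|\<mu>. \<bar>g x \<bullet> b\<bar>)"
          by (intro integral_mult_bound Linf_diff wn u gb AE_domI close)
        finally show "norm ((LINT x|\<mu>. w n x * (g x \<bullet> b)) - (LINT x|\<mu>. u x * (g x \<bullet> b)))
          \<le> norm (e n * (LINT x|\<mu>. \<bar>g x \<bullet> b\<bar>))" by simp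
      qed
    qed
    then have "(\<lambda>n. - (LINT x|\<mu>. (G n x \<bullet> b) * \<psi> x)) \<longlonglongrightarrow> - (LINT x|\<mu>. (G' x \<bullet> b) * \<psi> x)"
      using has_weak_gradientD[OF hn t b] has_weak_gradientD[OF hu t b] by simp
    then show ?thesis by (simp add: tendsto_minus_cancel_left)
  qed
  obtain \<psi> g C where \<psi>: "\<And>n::nat. test_function \<Omega> (\<psi> n) (g n)" "\<And>n x. \<bar>\<psi> n x\<bar> \<le> C"
    "AE x in \<mu>. (\<lambda>n. \<psi> n x) \<longlonglongrightarrow> F x" using F by (rule test_functions_dense) blast
  obtain A where A: "A \<ge> 0" "AE x in \<mu>. norm (F x) \<le> A" using F by (rule Linf_boundE)
  define \<delta> where "\<delta> k = (LINT x|\<mu>. \<bar>F x - \<psi> k x\<bar>)" for k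
  have \<psi>L: "\<psi> k \<in> Linf \<Omega>" for k by (rule test_function_Linf(1)[OF \<psi>(1)])
  have "\<delta> \<longlonglongrightarrow> (LINT x|\<mu>. 0)"
    unfolding \<delta>_def
  proof (rule integral_bounded_convergence[where C="A + C"])
    show "AE x in \<mu>. (\<lambda>k. \<bar>F x - \<psi> k x\<bar>) \<longlonglongrightarrow> 0"
      using \<psi>(3)
    proof eventually_elim
      case (elim x)
      have "(\<lambda>k. \<bar>F x - \<psi> k x\<bar>) \<longlonglongrightarrow> \<bar>F x - F x\<bar>"
        by (intro tendsto_rabs tendsto_diff tendsto_const elim)
      then show ?case by simp
    qed
    show "AE x in \<mu>. \<bar>\<bar>F x - \<psi> k x\<bar>\<bar> \<le> A + C" for k
      using A(2)
    proof eventually_elim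
      case (elim x) then show ?case using \<psi>(2)[of k x] by simp
    qed
  qed (use F \<psi>L in \<open>auto simp: Linf_measurable\<close>)
  then have \<delta>: "\<delta> \<longlonglongrightarrow> 0" by simp
  define M where "M = max 0 L + L' + 1"
  have M: "M > 0" using L' by (simp add: M_def)
  have approx: "\<bar>(LINT x|\<mu>. (G n x \<bullet> b) * F x) - (LINT x|\<mu>. (G' x \<bullet> b) * F x)\<bar>
      \<le> M * \<delta> k + \<bar>(LINT x|\<mu>. (G n x \<bullet> b) * \<psi> k x) - (LINT x|\<mu>. (G' x \<bullet> b) * \<psi> k x)\<bar>" for n k
  proof -
    have d: "(LINT x|\<mu>. H x * F x) - (LINT x|\<mu>. H x * \<psi> k x) = (LINT x|\<mu>. H x * (F x - \<psi> k x))"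
      if "H \<in> Linf \<Omega>" for H
      using that F \<psi>L[of k] by (simp add: right_diff_distrib Bochner_Integration.integral_diff Linf_integrable Linf_mult)
    have "\<bar>(LINT x|\<mu>. (G n x \<bullet> b) * F x) - (LINT x|\<mu>. (G n x \<bullet> b) * \<psi> k x)\<bar> \<le> L * \<delta> k"
      unfolding d[OF GnbL(1)] \<delta>_def by (intro integral_mult_bound Linf_diff GnbL F \<psi>L bound bound')
    moreover have "\<bar>(LINT x|\<mu>. (G' x \<bullet> b) * F x) - (LINT x|\<mu>. (G' x \<bullet> b) * \<psi> k x)\<bar> \<le> L' * \<delta> k"
      unfolding d[OF GnbL(2)] \<delta>_def by (intro integral_mult_bound Linf_diff GnbL F \<psi>L bound bound')
    moreover have "(L + L') * \<delta> k \<le> M * \<delta> k"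
      unfolding M_def \<delta>_def by (intro mult_right_mono integral_nonneg_AE) auto
    ultimately show ?thesis by (simp add: distrib_right)
  qed
  show ?thesis
  proof (rule LIMSEQ_I)
    fix r :: real assume r: "r > 0"
    have "\<forall>\<^sub>F k in sequentially. \<delta> k < r / (2 * M)"
      using \<delta> r M by (intro order_tendstoD) auto
    then obtain k where "\<delta> k < r / (2 * M)" by (auto dest: eventually_happens)
    then have k: "M * \<delta> k < r / 2" using M by (simp add: field_simps)
    obtain N where N: "\<And>n. n \<ge> N \<Longrightarrow>
        norm ((LINT x|\<mu>. (G n x \<bullet> b) * \<psi> k x) - (LINT x|\<mu>. (G' x \<bullet> b) * \<psi> k x)) < r / 2"
      using LIMSEQ_D[OF test[OF \<psi>(1)[of k]], of "r / 2"] r by auto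
    show "\<exists>no. \<forall>n\<ge>no. norm ((LINT x|\<mu>. (G n x \<bullet> b) * F x) - (LINT x|\<mu>. (G' x \<bullet> b) * F x)) < r"
    proof (intro exI allI impI)
      fix n assume "N \<le> n"
      from N[OF this] approx[of n k] k
      show "norm ((LINT x|\<mu>. (G n x \<bullet> b) * F x) - (LINT x|\<mu>. (G' x \<bullet> b) * F x)) < r"
        by (simp add: real_norm_def)
    qed
  qed
qed

end

section \<open>Smooth approximation on convex domains\<close>

lemma bump_commute: "bump z r y = bump y r z"
  by (simp add: bump_def norm_minus_commute)

lemma bump_grad_commute: "bump_grad z r y = - bump_grad y r z"
  by (simp add: bump_grad_def norm_minus_commute scaleR_diff_right)

text \<open>
  Only the bump depends on \<open>y\<close>, so one may differentiate under the integral sign. Integrating over a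
  fixed box keeps this valid without decay of \<open>U\<close>; the box will contain \<open>\<Omega>\<close>.
\<close>

lemma mollification_C1:
  fixes U :: "'a::euclidean_space \<Rightarrow> real"
  assumes U: "continuous_on UNIV U"
  shows "C1_fun (\<lambda>y. integral (cbox a b) (\<lambda>z. U z * bump z r y))
    (\<lambda>y. integral (cbox a b) (\<lambda>z. U z *\<^sub>R bump_grad z r y))"
  unfolding C1_fun_def
proof (intro conjI allI)
  have cg: "continuous_on (UNIV \<times> cbox a b) (\<lambda>(y, z). U z *\<^sub>R bump_grad z r y)"
    unfolding bump_grad_def split_def by (intro continuous_intros continuous_on_compose2[OF U]) auto
  then show "continuous_on UNIV (\<lambda>y. integral (cbox a b) (\<lambda>z. U z *\<^sub>R bump_grad z r y))"
    by (rule integral_continuous_on_param)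
  fix y
  have cb: "continuous_on (cbox a b) (\<lambda>z. U z * bump z r x)" for x
    unfolding bump_def by (intro continuous_intros continuous_on_subset[OF U]) auto
  have cgy: "continuous_on (cbox a b) (\<lambda>z. U z *\<^sub>R bump_grad z r y)"
    unfolding bump_grad_def by (intro continuous_intros continuous_on_subset[OF U]) auto
  have "((\<lambda>y. integral (cbox a b) (\<lambda>z. U z * bump z r y)) has_derivative
      blinfun_apply (integral (cbox a b) (\<lambda>z. blinfun_inner_left (U z *\<^sub>R bump_grad z r y)))) (at y within UNIV)"
  proof (rule leibniz_rule)
    fix x z :: 'a
    have "(bump z r has_derivative (\<lambda>v. v \<bullet> bump_grad z r x)) (at x)"
      using C1_fun_GDERIV[OF C1_fun_bump] by (simp only: gderiv_def)
    then have "((\<lambda>x. U z * bump z r x) has_derivative (\<lambda>v. U z * (v \<bullet> bump_grad z r x))) (at x)"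
      by (rule has_derivative_mult_right)
    then show "((\<lambda>x. U z * bump z r x) has_derivative
        blinfun_apply (blinfun_inner_left (U z *\<^sub>R bump_grad z r x))) (at x within UNIV)"
      by simp
    show "(\<lambda>z. U z * bump z r x) integrable_on cbox a b"
      using cb by (rule integrable_continuous)
    have "continuous_on (UNIV \<times> cbox a b) (\<lambda>p. blinfun_inner_left (case p of (y, z) \<Rightarrow> U z *\<^sub>R bump_grad z r y))"
      using cg by (intro continuous_intros)
    then show "continuous_on (UNIV \<times> cbox a b) (\<lambda>(y, z). blinfun_inner_left (U z *\<^sub>R bump_grad z r y))"
      by (simp add: split_def)
  qed auto
  moreover have "integral (cbox a b) (\<lambda>z. blinfun_inner_left (U z *\<^sub>R bump_grad z r y)) =
      blinfun_inner_left (integral (cbox a b) (\<lambda>z. U z *\<^sub>R bump_grad z r y))"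
    using integral_linear[OF integrable_continuous[OF cgy] bounded_linear_blinfun_inner_left]
    by (simp add: o_def)
  ultimately show "GDERIV (\<lambda>y. integral (cbox a b) (\<lambda>z. U z * bump z r y)) y :>
      integral (cbox a b) (\<lambda>z. U z *\<^sub>R bump_grad z r y)"
    by (simp add: gderiv_def)
qed

locale convex_domain = bounded_open_set +
  assumes convex_dom: "convex \<Omega>"
begin

text \<open>
  Shrinking the closure of \<open>\<Omega>\<close> slightly towards an interior point \<open>c\<close> maps it into a compact
  subset of \<open>\<Omega>\<close>, by convexity. There \<open>u\<close> can be mollified at a scale \<open>\<epsilon>\<close> that never leaves \<open>\<Omega>\<close>.
  The gradient of the mollified function is the bump-weighted mean of \<open>G\<close>, since the bump itself is a test
  function; a mean of vectors of norm at most \<open>L\<close> has norm at most \<open>L\<close>, and composing with the shrinking map only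
  decreases the gradient. So the bound \<open>L\<close> is preserved exactly.
\<close>

lemma smooth_approximation:
  assumes cont: "continuous_on (closure \<Omega>) u" and hu: "has_weak_gradient \<Omega> u G"
    and Gm: "G \<in> borel_measurable \<mu>" and GL: "AE x in \<mu>. norm (G x) \<le> L"
    and L: "L \<ge> 0" and \<eta>: "\<eta> > 0"
  obtains w h where "C1_fun w h" "\<And>x. x \<in> closure \<Omega> \<Longrightarrow> \<bar>w x - u x\<bar> \<le> \<eta>"
    "\<And>x. x \<in> closure \<Omega> \<Longrightarrow> norm (h x) \<le> L"
proof -
  have comp: "compact (closure \<Omega>)" using bounded_dom by (simp add: compact_closure)
  have sub: "\<Omega> \<subseteq> closure \<Omega>" by (rule closure_subset)
  obtain c where c: "c \<in> \<Omega>" using nonempty_dom by blast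
  obtain a b where ab: "\<Omega> \<subseteq> cbox a b" using bounded_subset_cbox_symmetric[OF bounded_dom] by metis
  obtain D where D: "D > 0" "\<And>x. x \<in> closure \<Omega> \<Longrightarrow> norm (x - c) \<le> D"
  proof -
    have "bounded ((\<lambda>x. x - c) ` closure \<Omega>)"
      using comp by (intro compact_imp_bounded compact_continuous_image continuous_intros)
    then obtain D where "D > 0" "\<forall>y\<in>(\<lambda>x. x - c) ` closure \<Omega>. norm y \<le> D" using bounded_pos by metis
    then show ?thesis using that by blast
  qed
  have "uniformly_continuous_on (closure \<Omega>) u" using cont comp by (rule compact_uniformly_continuous)
  then obtain \<delta> where \<delta>: "\<delta> > 0" "\<And>x y. x \<in> closure \<Omega> \<Longrightarrow> y \<in> closure \<Omega> \<Longrightarrow> dist y x < \<delta> \<Longrightarrow> dist (u y) (u x) < \<eta>"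
    using \<eta> unfolding uniformly_continuous_on_def by metis
  \<comment> \<open>The shrinking moves points by at most \<open>t D\<close>; together with the scale \<open>\<epsilon>\<close> this stays below \<open>\<delta>\<close>.\<close>
  define t where "t = min (1/2) (\<delta> / (4 * D))"
  have t: "0 < t" "t < 1" "t * D < \<delta> / 2"
  proof -
    show "0 < t" "t < 1" using \<delta>(1) D(1) by (auto simp: t_def)
    have "t * D \<le> \<delta> / (4 * D) * D" using D(1) by (intro mult_right_mono) (auto simp: t_def)
    then show "t * D < \<delta> / 2" using \<delta>(1) D(1) by simp
  qed
  define dil where "dil x = x - t *\<^sub>R (x - c)" for x
  have dil_in: "dil x \<in> \<Omega>" if "x \<in> closure \<Omega>" for x
    using mem_interior_closure_convex_shrink[OF convex_dom _ that t(1)] t(2) c open_dom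
    by (simp add: dil_def interior_open)
  have "compact (dil ` closure \<Omega>)"
    using comp unfolding dil_def by (intro compact_continuous_image continuous_intros)
  then obtain \<epsilon>0 where \<epsilon>0: "\<epsilon>0 > 0" "(\<Union>x\<in>dil ` closure \<Omega>. cball x \<epsilon>0) \<subseteq> \<Omega>"
    using compact_subset_open_imp_cball_epsilon_subset[OF _ open_dom] dil_in by (metis image_subsetI)
  define \<epsilon> where "\<epsilon> = min \<epsilon>0 (\<delta> / 4)"
  have \<epsilon>: "\<epsilon> > 0" "\<epsilon> < \<delta> / 2" using \<epsilon>0(1) \<delta>(1) by (auto simp: \<epsilon>_def)
  have ball_in: "cball (dil x) \<epsilon> \<subseteq> \<Omega>" if "x \<in> closure \<Omega>" for x
    using \<epsilon>0(2) that by (fastforce simp: \<epsilon>_def)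
  \<comment> \<open>A continuous extension of \<open>u\<close> to the whole space; only its values in \<open>\<Omega>\<close> matter in the end.\<close>
  define U where "U z = u (closest_point (closure \<Omega>) z)" for z
  have U: "continuous_on UNIV U"
  proof -
    have "continuous_on UNIV (closest_point (closure \<Omega>))"
      using convex_dom nonempty_dom by (intro continuous_on_closest_point) (auto simp: convex_closure)
    then show ?thesis unfolding U_def
      using nonempty_dom by (intro continuous_on_compose2[OF cont]) (auto intro: closest_point_in_set)
  qed
  have Uu: "U z = u z" if "z \<in> \<Omega>" for z
    using that sub by (simp add: U_def closest_point_self subset_iff)
  define M where "M y = integral (cbox a b) (\<lambda>z. U z * bump z \<epsilon> y)" for y
  define dM where "dM y = integral (cbox a b) (\<lambda>z. U z *\<^sub>R bump_grad z \<epsilon> y)" for y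
  have C1M: "C1_fun M dM" unfolding M_def dM_def by (rule mollification_C1[OF U])
  define Z where "Z = (LINT z|lborel. bump (0::'a) \<epsilon> z)"
  have to_leb: "integral (cbox a b) f = (LINT z|\<mu>. f z)"
    if "continuous_on UNIV f" "\<And>z. z \<notin> \<Omega> \<Longrightarrow> f z = 0" for f :: "'a \<Rightarrow> real"
  proof -
    have "f \<in> Linf \<Omega>" using that(1) by (intro Linf_continuous) (auto intro: continuous_on_subset)
    then have "(LINT z|\<mu>. f z) = integral \<Omega> f"
      using dom_lebesgue by (intro lebesgue_integral_eq_integral Linf_integrable)
    also have "\<dots> = integral UNIV (\<lambda>z. if z \<in> \<Omega> then f z else 0)" by (simp add: integral_restrict_UNIV)
    also have "(\<lambda>z. if z \<in> \<Omega> then f z else 0) = (\<lambda>z. if z \<in> cbox a b then f z else 0)"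
      using that(2) ab by (auto simp: fun_eq_iff)
    also have "integral UNIV \<dots> = integral (cbox a b) f" by (simp add: integral_restrict_UNIV)
    finally show ?thesis ..
  qed
  have cbump: "continuous_on S (bump y \<epsilon>)" "continuous_on S (bump_grad y \<epsilon>)" for S and y :: 'a
    using C1_fun_continuous[OF C1_fun_bump] C1_fun_continuous_grad[OF C1_fun_bump] by blast+
  have bumpL: "bump y \<epsilon> \<in> Linf \<Omega>" for y by (intro Linf_continuous cbump)
  have Z: "(LINT z|\<mu>. bump y \<epsilon> z) = Z" if "cball y \<epsilon> \<subseteq> \<Omega>" for y
  proof -
    have m: "bump y \<epsilon> \<in> borel_measurable borel" for y :: 'a
      by (rule borel_measurable_continuous_onI[OF cbump(1)])
    have "(LINT z|\<mu>. bump y \<epsilon> z) = (LINT z|lborel. bump y \<epsilon> z)"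
      using that ball_subset_cball[of y \<epsilon>] \<epsilon>(1) by (intro integral_supported m bump_outside) blast+
    also have "\<dots> = (LINT z|lborel. bump 0 \<epsilon> (z + - y))" by (simp add: bump_def)
    also have "\<dots> = Z" unfolding Z_def by (rule integral_translation_lborel[OF m])
    finally show ?thesis .
  qed
  have Zpos: "Z > 0"
  proof -
    have B: "cball (dil c) \<epsilon> \<subseteq> \<Omega>" using c sub by (intro ball_in) auto
    have "(LINT z|\<mu>. bump (dil c) \<epsilon> z) > 0"
    proof (rule integral_pos_on_ball[OF bumpL bump_nonneg _ \<epsilon>(1)])
      show "ball (dil c) \<epsilon> \<subseteq> \<Omega>" using B ball_subset_cball by blast
    qed (rule bump_pos[OF \<epsilon>(1)])
    then show ?thesis using Z[OF B] by simp
  qed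
  have gradM: "norm (dM y) \<le> L * Z" if y: "cball y \<epsilon> \<subseteq> \<Omega>" for y
  proof -
    have t: "test_function \<Omega> (bump y \<epsilon>) (bump_grad y \<epsilon>)" using \<epsilon>(1) y by (rule test_function_bump)
    have gL: "(\<lambda>x. G x \<bullet> v) \<in> Linf \<Omega>" for v
      using Linf_I[OF Gm GL] by (intro Linf_inner Linf_const)
    have cgU: "continuous_on UNIV (\<lambda>z. U z *\<^sub>R bump_grad z \<epsilon> y)"
      unfolding bump_grad_commute[of _ \<epsilon> y] by (intro continuous_intros U cbump)
    have comp: "dM y \<bullet> k = (LINT x|\<mu>. (G x \<bullet> k) * bump y \<epsilon> x)" if k: "k \<in> Basis" for k
    proof -
      have "dM y \<bullet> k = integral (cbox a b) (\<lambda>z. (U z *\<^sub>R bump_grad z \<epsilon> y) \<bullet> k)"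
        unfolding dM_def
        by (rule integral_component_eq[symmetric], rule integrable_continuous) (rule continuous_on_subset[OF cgU], simp)
      also have "\<dots> = (LINT z|\<mu>. (U z *\<^sub>R bump_grad z \<epsilon> y) \<bullet> k)"
      proof (rule to_leb)
        show "(U z *\<^sub>R bump_grad z \<epsilon> y) \<bullet> k = 0" if "z \<notin> \<Omega>" for z
        proof -
          have "z \<notin> ball y \<epsilon>" using that y ball_subset_cball by blast
          then have "bump_grad y \<epsilon> z = 0" by (rule bump_grad_outside[OF \<epsilon>(1)])
          then show ?thesis by (simp add: bump_grad_commute[of z \<epsilon> y])
        qed
      qed (intro continuous_intros cgU)
      also have "\<dots> = (LINT z|\<mu>. - (u z * (bump_grad y \<epsilon> z \<bullet> k)))"
        by (intro Bochner_Integration.integral_cong) (auto simp: Uu bump_grad_commute[of _ \<epsilon> y])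
      also have "\<dots> = (LINT x|\<mu>. (G x \<bullet> k) * bump y \<epsilon> x)"
        using has_weak_gradientD[OF hu t k] by simp
      finally show ?thesis .
    qed
    have "dM y \<bullet> v = (LINT x|\<mu>. (G x \<bullet> v) * bump y \<epsilon> x)" for v
    proof -
      have "dM y \<bullet> v = (\<Sum>k\<in>Basis. (v \<bullet> k) * (LINT x|\<mu>. (G x \<bullet> k) * bump y \<epsilon> x))"
        by (simp add: euclidean_inner[of "dM y" v] comp mult.commute)
      also have "\<dots> = (LINT x|\<mu>. (\<Sum>k\<in>Basis. (v \<bullet> k) * ((G x \<bullet> k) * bump y \<epsilon> x)))"
        by (subst Bochner_Integration.integral_sum)
           (auto intro!: Linf_integrable Linf_mult gL bumpL Linf_const)
      also have "\<dots> = (LINT x|\<mu>. (G x \<bullet> v) * bump y \<epsilon> x)"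
        by (intro Bochner_Integration.integral_cong)
           (auto simp: euclidean_inner[of _ v] sum_distrib_left sum_distrib_right mult_ac)
      finally show ?thesis .
    qed
    \<comment> \<open>The choice \<open>v = dM y\<close> turns the componentwise formula into a bound on the norm.\<close>
    then have "(norm (dM y))\<^sup>2 = (LINT x|\<mu>. (G x \<bullet> dM y) * bump y \<epsilon> x)"
      by (simp add: power2_norm_eq_inner)
    also have "\<dots> \<le> L * norm (dM y) * (LINT x|\<mu>. \<bar>bump y \<epsilon> x\<bar>)"
    proof (rule order_trans[OF abs_ge_self integral_mult_bound[OF gL bumpL]])
      show "AE x in \<mu>. \<bar>G x \<bullet> dM y\<bar> \<le> L * norm (dM y)"
        using GL by eventually_elim (rule order_trans[OF Cauchy_Schwarz_ineq2], simp add: mult_right_mono)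
    qed
    also have "\<dots> = L * norm (dM y) * Z" using Z[OF y] by (simp add: bump_nonneg)
    finally have "norm (dM y) * norm (dM y) \<le> norm (dM y) * (L * Z)"
      by (simp add: power2_eq_square mult_ac)
    then show ?thesis using L Zpos by (cases "dM y = 0") auto
  qed
  have valM: "\<bar>M (dil x) - u x * Z\<bar> \<le> \<eta> * Z" if x: "x \<in> closure \<Omega>" for x
  proof -
    let ?y = "dil x"
    have y: "cball ?y \<epsilon> \<subseteq> \<Omega>" using x by (rule ball_in)
    have "M ?y = (LINT z|\<mu>. U z * bump ?y \<epsilon> z)"
      unfolding M_def bump_commute[of _ \<epsilon> ?y]
    proof (rule to_leb)
      show "U z * bump ?y \<epsilon> z = 0" if "z \<notin> \<Omega>" for z
      proof -
        have "z \<notin> ball ?y \<epsilon>" using that y ball_subset_cball by blast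
        then have "bump ?y \<epsilon> z = 0" by (rule bump_outside[OF \<epsilon>(1)])
        then show ?thesis by simp
      qed
    qed (intro continuous_intros U cbump)
    then have "M ?y - u x * Z = (LINT z|\<mu>. U z * bump ?y \<epsilon> z) - (LINT z|\<mu>. u x * bump ?y \<epsilon> z)"
      using Z[OF y] by simp
    also have "\<dots> = (LINT z|\<mu>. U z * bump ?y \<epsilon> z - u x * bump ?y \<epsilon> z)"
      by (intro Bochner_Integration.integral_diff[symmetric] Linf_integrable Linf_mult bumpL Linf_const
          Linf_continuous continuous_on_subset[OF U]) auto
    also have "\<bar>\<dots>\<bar> \<le> (LINT z|\<mu>. \<eta> * bump ?y \<epsilon> z)"
      unfolding real_norm_def[symmetric]
    proof (rule Bochner_Integration.integral_norm_bound_integral)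
      fix z assume "z \<in> space \<mu>"
      then have z: "z \<in> \<Omega>" by simp
      show "norm (U z * bump ?y \<epsilon> z - u x * bump ?y \<epsilon> z) \<le> \<eta> * bump ?y \<epsilon> z"
      proof (cases "z \<in> ball ?y \<epsilon>")
        case True
        have "dist z x \<le> dist z ?y + dist ?y x" by (rule dist_triangle)
        also have "dist ?y x = t * norm (x - c)" using t(1) by (simp add: dil_def dist_norm)
        also have "\<dots> \<le> t * D" using D(2)[OF x] t(1) by (intro mult_left_mono) auto
        finally have "dist z x < \<delta>" using True t(3) \<epsilon>(2) by (simp add: dist_commute)
        then have "\<bar>U z - u x\<bar> < \<eta>" using \<delta>(2)[OF x, of z] z sub Uu by (auto simp: dist_real_def)
        moreover have "norm (U z * bump ?y \<epsilon> z - u x * bump ?y \<epsilon> z) = \<bar>U z - u x\<bar> * bump ?y \<epsilon> z"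
          by (simp add: abs_mult bump_nonneg flip: left_diff_distrib)
        ultimately show ?thesis by (simp add: mult_right_mono bump_nonneg)
      next
        case False
        then have "bump ?y \<epsilon> z = 0" by (rule bump_outside[OF \<epsilon>(1)])
        then show ?thesis by simp
      qed
    qed (intro Linf_integrable Linf_diff Linf_mult bumpL Linf_const
          Linf_continuous[OF continuous_on_subset[OF U]] subset_UNIV)+
    finally show ?thesis using Z[OF y] by simp
  qed
  show ?thesis
  proof
    have C1w: "C1_fun (\<lambda>x. M (dil x)) (\<lambda>x. (1 - t) *\<^sub>R dM (dil x))"
      unfolding C1_fun_def
    proof (intro conjI allI)
      fix x
      have "((\<lambda>x. M (dil x)) has_derivative (\<lambda>v. (v - t *\<^sub>R v) \<bullet> dM (dil x))) (at x)"
      proof (rule has_derivative_compose[where g=M])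
        show "(dil has_derivative (\<lambda>v. v - t *\<^sub>R v)) (at x)"
          unfolding dil_def by (auto intro!: derivative_eq_intros)
        show "(M has_derivative (\<lambda>v. v \<bullet> dM (dil x))) (at (dil x))"
          using C1_fun_GDERIV[OF C1M] by (simp only: gderiv_def)
      qed
      then show "GDERIV (\<lambda>x. M (dil x)) x :> (1 - t) *\<^sub>R dM (dil x)"
        unfolding gderiv_def by (rule has_derivative_eq_rhs) (simp add: fun_eq_iff inner_simps algebra_simps)
      have "continuous_on UNIV dil" unfolding dil_def by (intro continuous_intros)
      then show "continuous_on UNIV (\<lambda>x. (1 - t) *\<^sub>R dM (dil x))"
        by (intro continuous_intros continuous_on_compose2[OF C1_fun_continuous_grad[OF C1M, of UNIV]]) auto
    qed
    show "C1_fun (\<lambda>x. (1 / Z) * M (dil x)) (\<lambda>x. (1 / Z) *\<^sub>R ((1 - t) *\<^sub>R dM (dil x)))"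
      by (rule C1_fun_cmult[OF C1w])
    fix x assume x: "x \<in> closure \<Omega>"
    have "1 / Z * M (dil x) - u x = (M (dil x) - u x * Z) / Z" using Zpos by (simp add: field_simps)
    then show "\<bar>1 / Z * M (dil x) - u x\<bar> \<le> \<eta>"
      using valM[OF x] Zpos by (simp add: abs_divide pos_divide_le_eq)
    have "norm ((1 - t) *\<^sub>R dM (dil x)) \<le> 1 * (L * Z)"
      unfolding norm_scaleR using t gradM[OF ball_in[OF x]] by (intro mult_mono) auto
    then show "norm ((1 / Z) *\<^sub>R ((1 - t) *\<^sub>R dM (dil x))) \<le> L"
      using Zpos by (simp add: pos_divide_le_eq)
  qed
qed

lemma smooth_approximation_sequence:
  assumes "continuous_on (closure \<Omega>) u" "has_weak_gradient \<Omega> u G"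
    "G \<in> borel_measurable \<mu>" "AE x in \<mu>. norm (G x) \<le> L" "L \<ge> 0"
  obtains w h where "\<And>n::nat. C1_fun (w n) (h n)"
    "\<And>n x. x \<in> closure \<Omega> \<Longrightarrow> \<bar>w n x - u x\<bar> \<le> 1 / real (Suc n)"
    "\<And>n x. x \<in> closure \<Omega> \<Longrightarrow> norm (h n x) \<le> L"
proof -
  have "\<exists>w h. C1_fun w h \<and> (\<forall>x\<in>closure \<Omega>. \<bar>w x - u x\<bar> \<le> 1 / real (Suc n)) \<and> (\<forall>x\<in>closure \<Omega>. norm (h x) \<le> L)"
    for n :: nat
  proof -
    have pos: "1 / real (Suc n) > 0" by simp
    show ?thesis by (rule smooth_approximation[OF assms pos]) blast
  qed
  then have "\<forall>n::nat. \<exists>wh. C1_fun (fst wh) (snd wh) \<and>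
      (\<forall>x\<in>closure \<Omega>. \<bar>fst wh x - u x\<bar> \<le> 1 / real (Suc n)) \<and> (\<forall>x\<in>closure \<Omega>. norm (snd wh x) \<le> L)"
    by simp
  from choice[OF this] obtain wh where "\<forall>n::nat. C1_fun (fst (wh n)) (snd (wh n)) \<and>
      (\<forall>x\<in>closure \<Omega>. \<bar>fst (wh n) x - u x\<bar> \<le> 1 / real (Suc n)) \<and> (\<forall>x\<in>closure \<Omega>. norm (snd (wh n) x) \<le> L)"
    by blast
  then show ?thesis by (intro that[of "\<lambda>n. fst (wh n)" "\<lambda>n. snd (wh n)"]) auto
qed

text \<open>
  The smooth approximations are Lipschitz with constant \<open>L\<close> by the mean value theorem, as the closure of
  \<open>\<Omega>\<close> is convex.
\<close>

lemma weak_gradient_lipschitz: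
  assumes "continuous_on (closure \<Omega>) u" "has_weak_gradient \<Omega> u G"
    "G \<in> borel_measurable \<mu>" "AE x in \<mu>. norm (G x) \<le> L" "L \<ge> 0"
    and x: "x \<in> closure \<Omega>" and y: "y \<in> closure \<Omega>"
  shows "\<bar>u x - u y\<bar> \<le> L * norm (x - y)"
proof (rule field_le_epsilon)
  fix e :: real assume "e > 0"
  then have e: "e / 2 > 0" by simp
  obtain w h where w: "C1_fun w h" "\<And>x. x \<in> closure \<Omega> \<Longrightarrow> \<bar>w x - u x\<bar> \<le> e / 2"
    "\<And>x. x \<in> closure \<Omega> \<Longrightarrow> norm (h x) \<le> L"
    by (rule smooth_approximation[OF assms(1-5) e]) blast
  have "\<bar>w x - w y\<bar> \<le> L * norm (x - y)"
    by (rule C1_fun_lipschitz[OF w(1) convex_closure[OF convex_dom] w(3) x y])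
  then show "\<bar>u x - u y\<bar> \<le> L * norm (x - y) + e" using w(2)[OF x] w(2)[OF y] by linarith
qed

lemma K_set_lipschitz:
  assumes "u \<in> K_set \<Omega>" "x \<in> closure \<Omega>" "y \<in> closure \<Omega>"
  shows "\<bar>u x - u y\<bar> \<le> norm (x - y)"
  using weak_gradient_lipschitz[OF K_setD(1,3)[OF assms(1)] Linf_measurable[OF K_setD(2)[OF assms(1)]]
      K_setD(4)[OF assms(1)] _ assms(2,3)] by simp

lemma has_weak_gradient_scale:
  assumes "has_weak_gradient \<Omega> u G"
  shows "has_weak_gradient \<Omega> (\<lambda>x. s * u x) (\<lambda>x. s *\<^sub>R G x)"
  using assms by (simp add: has_weak_gradient_def mult.assoc)

lemma K_set_scale:
  assumes u: "u \<in> K_set \<Omega>" and s: "\<bar>s\<bar> \<le> 1"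
  shows "(\<lambda>x. s * u x) \<in> K_set \<Omega>" "AE x in \<mu>. norm (weak_grad \<Omega> (\<lambda>x. s * u x) x) \<le> \<bar>s\<bar>"
proof -
  note K = K_setD[OF u]
  have c: "continuous_on (closure \<Omega>) (\<lambda>x. s * u x)" using K(1) by (intro continuous_intros)
  have m: "(\<lambda>x. s *\<^sub>R weak_grad \<Omega> u x) \<in> borel_measurable \<mu>" using Linf_measurable[OF K(2)] by simp
  have le: "AE x in \<mu>. norm (s *\<^sub>R weak_grad \<Omega> u x) \<le> \<bar>s\<bar>"
    using K(4) by eventually_elim (simp add: mult_left_le)
  then have "AE x in \<mu>. norm (s *\<^sub>R weak_grad \<Omega> u x) \<le> 1"
    by eventually_elim (use s in simp)
  note K' = K_setI[OF c has_weak_gradient_scale[OF K(3)] m this]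
  show "(\<lambda>x. s * u x) \<in> K_set \<Omega>" by (rule K'(1))
  show "AE x in \<mu>. norm (weak_grad \<Omega> (\<lambda>x. s * u x) x) \<le> \<bar>s\<bar>"
    using K'(2) le by eventually_elim simp
qed

end

section \<open>The energy and the mountain-pass level\<close>

lemma continuous_on_abs_powr: "r > 0 \<Longrightarrow> continuous_on UNIV (\<lambda>t::real. \<bar>t\<bar> powr r)"
  by (intro continuous_on_powr' continuous_intros) auto

lemma one_minus_sqrt_le: "0 \<le> y \<Longrightarrow> y \<le> 1 \<Longrightarrow> 1 - sqrt (1 - y) \<le> (y::real)"
proof -
  assume y: "0 \<le> y" "y \<le> 1"
  have "(1 - y)\<^sup>2 \<le> 1 - y" using y by (simp add: power2_eq_square mult_left_le)
  then have "1 - y \<le> sqrt (1 - y)" by (rule real_le_rsqrt)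
  then show ?thesis by simp
qed

locale weighted_domain = convex_domain +
  fixes a :: "'a \<Rightarrow> real" and p :: real
  assumes weight: "a \<in> Linf \<Omega>" and exponent: "p > 2"
begin

definition vol :: real where "vol = (LINT x|\<mu>. 1)"

definition weighted_integral :: "('a \<Rightarrow> real) \<Rightarrow> real" where "weighted_integral u = (LINT x|\<mu>. a x * \<bar>u x\<bar> powr p)"

definition psi :: "('a \<Rightarrow> real) \<Rightarrow> real" where
  "psi u = (LINT x|\<mu>. 1 - sqrt (1 - (norm (weak_grad \<Omega> u x))\<^sup>2))"

lemma vol_nonneg: "vol \<ge> 0" by (simp add: vol_def)

lemma Phi_eq: "Phi \<Omega> a p lam u = - (lam / p) * weighted_integral u"
  by (simp add: Phi_def weighted_integral_def)

lemma weighted_integral_scale: "0 \<le> s \<Longrightarrow> weighted_integral (\<lambda>x. s * u x) = s powr p * weighted_integral u"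
proof -
  assume s: "0 \<le> s"
  have "weighted_integral (\<lambda>x. s * u x) = (LINT x|\<mu>. s powr p * (a x * \<bar>u x\<bar> powr p))"
    unfolding weighted_integral_def using s by (intro Bochner_Integration.integral_cong) (auto simp: abs_mult powr_mult)
  then show ?thesis by (simp add: weighted_integral_def)
qed

lemma energy_density_Linf:
  assumes "u \<in> K_set \<Omega>"
  shows "(\<lambda>x. 1 - sqrt (1 - (norm (weak_grad \<Omega> u x))\<^sup>2)) \<in> Linf \<Omega>"
  using K_setD(2)[OF assms] by (rule Linf_compose) (intro continuous_intros)

lemma psi_nonneg: "u \<in> K_set \<Omega> \<Longrightarrow> psi u \<ge> 0"
  unfolding psi_def by (rule integral_nonneg_AE) (auto dest!: K_setD(4) elim!: eventually_mono)

text \<open>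
  The integrand is at most the square of the norm of the gradient. For \<open>t u\<close>, whose gradient has norm at most \<open>t\<close>,
  this gives the quadratic term in the energy along the straight path.
\<close>

lemma psi_le:
  assumes u: "u \<in> K_set \<Omega>" and s: "AE x in \<mu>. norm (weak_grad \<Omega> u x) \<le> s"
  shows "psi u \<le> s\<^sup>2 * vol"
proof -
  have "psi u \<le> (LINT x|\<mu>. s\<^sup>2 * 1)"
    unfolding psi_def
  proof (rule integral_mono_AE)
    show "AE x in \<mu>. 1 - sqrt (1 - (norm (weak_grad \<Omega> u x))\<^sup>2) \<le> s\<^sup>2 * 1"
      using s K_setD(4)[OF u]
    proof eventually_elim
      case (elim x)
      then have "(norm (weak_grad \<Omega> u x))\<^sup>2 \<le> s\<^sup>2" "(norm (weak_grad \<Omega> u x))\<^sup>2 \<le> 1"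
        by (auto intro: power_mono power_le_one)
      then show ?case using one_minus_sqrt_le[of "(norm (weak_grad \<Omega> u x))\<^sup>2"] by simp
    qed
  qed (intro Linf_integrable energy_density_Linf[OF u] Linf_const)+
  then show ?thesis by (simp only: integral_mult_right_zero vol_def)
qed

lemma psi_le_vol: "u \<in> K_set \<Omega> \<Longrightarrow> psi u \<le> vol"
  using psi_le[of u 1] K_setD(4)[of u] by simp

lemma energy_K: "u \<in> K_set \<Omega> \<Longrightarrow> energy \<Omega> a p lam u = ereal (psi u - (lam / p) * weighted_integral u)"
  by (simp add: energy_def Psi_def psi_def Phi_eq)

text \<open>
  Each path starts with a function that vanishes on the closure of \<open>\<Omega>\<close>, and its energy is
  already nonnegative.
\<close>

lemma mountain_pass_level_nonneg: "mountain_pass_level \<Omega> a p lam w \<ge> 0"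
  unfolding mountain_pass_level_def
proof (rule INF_greatest)
  fix f assume f: "f \<in> paths_to \<Omega> w"
  then have f0: "f 0 x = 0" if "x \<in> \<Omega>" for x
    using that closure_subset[of \<Omega>] by (auto simp: paths_to_def)
  have c: "continuous_on (closure \<Omega>) (f 0)" using f by (auto simp: paths_to_def C_closure_def)
  have "has_weak_gradient \<Omega> (f 0) (\<lambda>_. 0)"
    unfolding has_weak_gradient_def
    by (auto intro!: Bochner_Integration.integral_eq_zero_AE AE_domI simp: f0)
  then have K: "f 0 \<in> K_set \<Omega>" using K_setI(1)[OF c] by simp
  have "weighted_integral (f 0) = 0"
    unfolding weighted_integral_def by (rule Bochner_Integration.integral_eq_zero_AE) (auto intro!: AE_domI simp: f0)
  then have "0 \<le> energy \<Omega> a p lam (f 0)" using psi_nonneg[OF K] by (simp add: energy_K[OF K])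
  also have "\<dots> \<le> (SUP t\<in>{0..1}. energy \<Omega> a p lam (f t))" by (rule SUP_upper) simp
  finally show "0 \<le> (SUP t\<in>{0..1}. energy \<Omega> a p lam (f t))" .
qed

text \<open>
  A bump supported in a ball where \<open>a > 0\<close>, scaled so that its gradient has norm at most \<open>1\<close>.
\<close>

lemma exists_positive_weighted_integral:
  assumes "interior {x \<in> \<Omega>. a x > 0} \<noteq> {}"
  obtains \<phi> where "\<phi> \<in> K_set \<Omega>" "weighted_integral \<phi> > 0"
proof -
  obtain c where "c \<in> interior {x \<in> \<Omega>. a x > 0}" using assms by blast
  then obtain r where r: "r > 0" "ball c r \<subseteq> {x \<in> \<Omega>. a x > 0}"
    unfolding mem_interior by blast
  define k where "k = 1 / (4 * r^3)"
  have k: "k > 0" using r(1) by (simp add: k_def)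
  have C1: "C1_fun (\<lambda>x. k * bump c r x) (\<lambda>x. k *\<^sub>R bump_grad c r x)"
    by (rule C1_fun_cmult[OF C1_fun_bump])
  have bg: "norm (k *\<^sub>R bump_grad c r x) \<le> 1" for x
  proof (cases "x \<in> ball c r")
    case True
    have "norm (bump_grad c r x) = 4 * max 0 (r\<^sup>2 - (norm (x - c))\<^sup>2) * norm (x - c)"
      by (simp add: bump_grad_def abs_mult)
    also have "\<dots> \<le> 4 * r\<^sup>2 * r"
      using True r(1) by (intro mult_mono) (auto simp: dist_norm norm_minus_commute)
    also have "\<dots> = 4 * r^3" by (simp add: power2_eq_square power3_eq_cube)
    finally show ?thesis using r(1) by (simp add: k_def)
  qed (simp add: bump_grad_outside[OF r(1)])
  show ?thesis
  proof
    let ?\<phi> = "\<lambda>x. k * bump c r x"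
    show "?\<phi> \<in> K_set \<Omega>"
    proof (rule K_setI(1)[OF C1_fun_continuous[OF C1] C1_has_weak_gradient[OF C1]])
      show "(\<lambda>x. k *\<^sub>R bump_grad c r x) \<in> borel_measurable \<mu>"
        by (intro Linf_measurable Linf_continuous C1_fun_continuous_grad[OF C1])
      show "AE x in \<mu>. norm (k *\<^sub>R bump_grad c r x) \<le> 1" using bg by simp
    qed
    show "weighted_integral ?\<phi> > 0"
      unfolding weighted_integral_def
    proof (rule integral_pos_on_ball[of _ c r])
      have "(\<lambda>x. \<bar>?\<phi> x\<bar> powr p) \<in> Linf \<Omega>"
        using exponent by (intro Linf_compose[OF _ continuous_on_abs_powr] Linf_continuous C1_fun_continuous[OF C1]) auto
      then show "(\<lambda>x. a x * \<bar>?\<phi> x\<bar> powr p) \<in> Linf \<Omega>" by (intro Linf_mult weight)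
      show "ball c r \<subseteq> \<Omega>" using r(2) by blast
      show "a x * \<bar>?\<phi> x\<bar> powr p > 0" if "x \<in> ball c r" for x
        using that r k bump_pos[OF r(1) that] by auto
      show "a x * \<bar>?\<phi> x\<bar> powr p \<ge> 0" for x
      proof (cases "x \<in> ball c r")
        case True then show ?thesis using r(2) by (auto simp: less_imp_le)
      next
        case False
        then have "bump c r x = 0" by (rule bump_outside[OF r(1)])
        then show ?thesis by simp
      qed
    qed (rule r(1))
  qed
qed

lemma scaled_path:
  assumes u: "u \<in> K_set \<Omega>"
  shows "(\<lambda>t x. t * u x) \<in> paths_to \<Omega> u"
  unfolding paths_to_def C_closure_def
proof (intro CollectI conjI ballI)
  have c: "continuous_on (closure \<Omega>) u" by (rule K_setD(1)[OF u])
  then show "continuous_on (closure \<Omega>) (\<lambda>x. t * u x)" for t by (intro continuous_intros)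
  fix t :: real
  have "bounded (u ` closure \<Omega>)"
    using c bounded_dom by (intro compact_imp_bounded compact_continuous_image) (auto simp: compact_closure)
  moreover have "((\<lambda>s. s) \<longlongrightarrow> t) (at t within {0..1})" by (rule tendsto_ident_at)
  ultimately have "uniform_limit (closure \<Omega>) (\<lambda>s x. s * u x) (\<lambda>x. t * u x) (at t within {0..1})"
    by (intro uniform_lim_mult uniform_limit_const) (auto simp: uniform_limit_iff tendsto_iff dist_real_def bounded_iff)
  then show "uniform_limit (closure \<Omega>) (\<lambda>t x. t * u x) (\<lambda>x. t * u x) (at t within {0..1})" .
qed auto

text \<open>
  If \<open>lam B s^(p-2) \<ge> V\<close>, the left side is nonpositive. Otherwise \<open>s^(p-2) < V / (lam B)\<close>
  bounds \<open>s^2\<close>, and the negative term may be dropped.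
\<close>

lemma scaling_maximum:
  fixes V B lam s :: real
  assumes "V \<ge> 0" "B > 0" "lam > 0" "0 \<le> s"
  shows "s\<^sup>2 * V - lam * B * s powr p \<le> V * (V / B) powr (2 / (p - 2)) * lam powr (- (2 / (p - 2)))"
proof (cases "s = 0")
  case True
  then show ?thesis using assms by simp
next
  case False
  then have s: "s > 0" using assms by simp
  have sp: "s powr p = s\<^sup>2 * s powr (p - 2)"
    using s by (simp add: powr_diff)
  have rhs: "V * (V / B) powr (2 / (p - 2)) * lam powr (- (2 / (p - 2))) = V * (V / (lam * B)) powr (2 / (p - 2))"
    using assms by (simp add: powr_divide powr_mult powr_minus divide_simps)
  show ?thesis
  proof (cases "V \<le> lam * B * s powr (p - 2)")
    case True
    then have "s\<^sup>2 * (V - lam * B * s powr (p - 2)) \<le> 0" by (intro mult_nonneg_nonpos) auto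
    then have "s\<^sup>2 * V - lam * B * s powr p \<le> 0" by (simp add: sp algebra_simps)
    also have "0 \<le> V * (V / B) powr (2 / (p - 2)) * lam powr (- (2 / (p - 2)))" using assms by simp
    finally show ?thesis .
  next
    case False
    then have "s powr (p - 2) \<le> V / (lam * B)" using assms by (simp add: field_simps)
    then have "(s powr (p - 2)) powr (2 / (p - 2)) \<le> (V / (lam * B)) powr (2 / (p - 2))"
      using exponent by (intro powr_mono2) auto
    moreover have "(s powr (p - 2)) powr (2 / (p - 2)) = s\<^sup>2"
    proof -
      have e: "(p - 2) * (2 / (p - 2)) = 2" using exponent by (simp add: divide_eq_eq)
      show ?thesis unfolding powr_powr e using s by simp
    qed
    ultimately have "s\<^sup>2 * V \<le> V * (V / (lam * B)) powr (2 / (p - 2))"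
      using assms(1) by (simp add: mult.commute mult_left_mono)
    moreover have "lam * B * s powr p \<ge> 0" using assms by simp
    ultimately show ?thesis unfolding rhs by linarith
  qed
qed

text \<open>
  The straight path \<open>t \<mapsto> t u\<close> is a competitor, and its energy is bounded by the function treated in
  \<open>scaling_maximum\<close>.
\<close>

lemma mountain_pass_level_le:
  assumes u: "u \<in> K_set \<Omega>" and B: "B > 0" "p * B \<le> weighted_integral u" and lam: "lam > 0"
  shows "mountain_pass_level \<Omega> a p lam u \<le> ereal (vol * (vol / B) powr (2 / (p - 2)) * lam powr (- (2 / (p - 2))))"
  unfolding mountain_pass_level_def
proof (rule INF_lower2[OF scaled_path[OF u]], rule SUP_least)
  fix t :: real assume t: "t \<in> {0..1}"
  have K: "(\<lambda>x. t * u x) \<in> K_set \<Omega>" using t by (intro K_set_scale[OF u]) auto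
  have "psi (\<lambda>x. t * u x) \<le> t\<^sup>2 * vol"
    using psi_le[OF K K_set_scale(2)[OF u]] t by auto
  moreover have "lam * B * t powr p \<le> lam / p * weighted_integral (\<lambda>x. t * u x)"
  proof -
    have "lam / p * (t powr p * (p * B)) \<le> lam / p * (t powr p * weighted_integral u)"
      using B lam exponent by (intro mult_left_mono) auto
    then show ?thesis using t exponent by (simp add: weighted_integral_scale mult_ac)
  qed
  ultimately have "psi (\<lambda>x. t * u x) - lam / p * weighted_integral (\<lambda>x. t * u x) \<le> t\<^sup>2 * vol - lam * B * t powr p"
    by linarith
  also have "\<dots> \<le> vol * (vol / B) powr (2 / (p - 2)) * lam powr (- (2 / (p - 2)))"
    using t by (intro scaling_maximum vol_nonneg B lam) auto
  finally show "energy \<Omega> a p lam (\<lambda>x. t * u x) \<le> ereal (vol * (vol / B) powr (2 / (p - 2)) * lam powr (- (2 / (p - 2))))"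
    unfolding energy_K[OF K] by simp
qed

lemma solution_K_set: "is_solution \<Omega> a p lam u \<Longrightarrow> u \<in> K_set \<Omega>"
  by (simp add: is_solution_def K_set_def less_imp_le)

text \<open>
  The gradient part of the energy lies between \<open>0\<close> and \<open>vol\<close>, so for large \<open>lam\<close> a minimiser almost maximises
  the weighted integral over \<open>K_set \<Omega>\<close>.
\<close>

lemma minimizer_weighted_integral_lower_bound:
  assumes u: "u \<in> K_set \<Omega>" and min: "energy \<Omega> a p lam u = (INF v\<in>C_closure \<Omega>. energy \<Omega> a p lam v)"
    and \<phi>: "\<phi> \<in> K_set \<Omega>" "weighted_integral \<phi> > 0" and lam: "lam > 0" "lam \<ge> 2 * p * vol / weighted_integral \<phi>"
  shows "weighted_integral u \<ge> weighted_integral \<phi> / 2"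
proof -
  have "\<phi> \<in> C_closure \<Omega>" using \<phi>(1) by (simp add: K_set_def)
  then have "energy \<Omega> a p lam u \<le> energy \<Omega> a p lam \<phi>" unfolding min by (rule INF_lower)
  then have "psi u - lam / p * weighted_integral u \<le> psi \<phi> - lam / p * weighted_integral \<phi>"
    by (simp add: energy_K[OF u] energy_K[OF \<phi>(1)])
  then have "lam / p * (weighted_integral \<phi> - weighted_integral u) \<le> vol"
    using psi_nonneg[OF u] psi_le_vol[OF \<phi>(1)] by (simp add: algebra_simps)
  then have "lam * (weighted_integral \<phi> - weighted_integral u) \<le> p * vol" using exponent by (simp add: field_simps)
  also have "2 * p * vol \<le> lam * weighted_integral \<phi>" using lam(2) \<phi>(2) by (simp add: field_simps)
  then have "p * vol \<le> lam * (weighted_integral \<phi> / 2)" by simp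
  finally show ?thesis using lam(1) by simp
qed

section \<open>Solutions of nonnegative energy\<close>

definition odd_power :: "real \<Rightarrow> real" where "odd_power t = \<bar>t\<bar> powr (p - 2) * t"

lemma continuous_on_odd_power: "continuous_on UNIV odd_power"
  unfolding odd_power_def using exponent by (intro continuous_intros continuous_on_abs_powr) auto

lemma odd_power_mult: "odd_power (s * t) = odd_power s * odd_power t"
  by (simp add: odd_power_def abs_mult powr_mult mult_ac)

lemma odd_power_mult_self: "odd_power t * t = \<bar>t\<bar> powr p"
proof (cases "t = 0")
  case False
  have "\<bar>t\<bar> powr p = \<bar>t\<bar> powr (p - 2) * \<bar>t\<bar>\<^sup>2"
    using False by (simp add: powr_diff)
  then show ?thesis by (simp add: odd_power_def power2_eq_square mult.assoc)
qed (simp add: odd_power_def)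

lemma odd_power_eq_0: "odd_power t = 0 \<longleftrightarrow> t = 0"
  by (simp add: odd_power_def)

lemma weighted_odd_power_Linf: "continuous_on (closure \<Omega>) u \<Longrightarrow> (\<lambda>x. a x * odd_power (u x)) \<in> Linf \<Omega>"
  by (intro Linf_mult weight Linf_compose[OF _ continuous_on_odd_power] Linf_continuous)

text \<open>
  The strict inequality for the essential supremum leaves a gap below \<open>1\<close>, which keeps the
  denominator \<open>sqrt (1 - |\<nabla>u|^2)\<close> away from \<open>0\<close>.
\<close>

lemma solution_strict_bound:
  assumes "is_solution \<Omega> a p lam u"
  obtains r where "r < 1" "AE x in \<mu>. norm (weak_grad \<Omega> u x) \<le> r"
proof -
  have "Linf_norm \<Omega> (weak_grad \<Omega> u) < ereal 1" using assms by (simp add: is_solution_def one_ereal_def)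
  then obtain r where r: "Linf_norm \<Omega> (weak_grad \<Omega> u) < ereal r" "ereal r < ereal 1"
    using ereal_dense2 by blast
  have "AE x in \<mu>. norm (weak_grad \<Omega> u x) \<le> r"
    using esssup_AE[of "\<lambda>x. ereal (norm (weak_grad \<Omega> u x))" \<mu>]
  proof eventually_elim
    case (elim x)
    then have "ereal (norm (weak_grad \<Omega> u x)) < ereal r" using r(1) unfolding Linf_norm_def by (rule le_less_trans)
    then show ?case by simp
  qed
  then show ?thesis using r(2) by (intro that[of r]) auto
qed

lemma inverse_flux_Linf:
  assumes "is_solution \<Omega> a p lam u"
  shows "(\<lambda>x. 1 / sqrt (1 - (norm (weak_grad \<Omega> u x))\<^sup>2)) \<in> Linf \<Omega>"
proof -
  obtain r where r: "r < 1" "AE x in \<mu>. norm (weak_grad \<Omega> u x) \<le> r"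
    using assms by (rule solution_strict_bound)
  define q where "q = max 0 r"
  have q: "0 \<le> q" "q < 1" using r(1) by (auto simp: q_def)
  have q2: "q\<^sup>2 < 1" using q by (simp add: power_less_one_iff)
  have [measurable]: "weak_grad \<Omega> u \<in> borel_measurable \<mu>"
    using K_setD(2)[OF solution_K_set[OF assms]] by (rule Linf_measurable)
  show ?thesis
  proof (rule Linf_I)
    show "AE x in \<mu>. norm (1 / sqrt (1 - (norm (weak_grad \<Omega> u x))\<^sup>2)) \<le> 1 / sqrt (1 - q\<^sup>2)"
      using r(2)
    proof eventually_elim
      case (elim x)
      then have "(norm (weak_grad \<Omega> u x))\<^sup>2 \<le> q\<^sup>2" by (intro power_mono) (auto simp: q_def)
      then have "sqrt (1 - q\<^sup>2) \<le> sqrt (1 - (norm (weak_grad \<Omega> u x))\<^sup>2)" by simp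
      moreover have "0 < sqrt (1 - q\<^sup>2)" using q2 by simp
      ultimately show ?case by (simp add: frac_le)
    qed
  qed measurable
qed

text \<open>
  A solution is only known to be Lipschitz, while test functions are \<open>C\<^sup>1\<close> up to the boundary. Its smooth
  approximations are admissible; their gradients converge weakly, which is enough because the gradient of the test function enters
  linearly, multiplied by a bounded field.
\<close>

lemma solution_tested_with_itself:
  assumes sol: "is_solution \<Omega> a p lam u"
  shows "(LINT x|\<mu>. (norm (weak_grad \<Omega> u x))\<^sup>2 / sqrt (1 - (norm (weak_grad \<Omega> u x))\<^sup>2)) = lam * weighted_integral u"
proof -
  let ?G = "weak_grad \<Omega> u"
  let ?W = "\<lambda>x. 1 / sqrt (1 - (norm (?G x))\<^sup>2)"
  note K = K_setD[OF solution_K_set[OF sol]]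
  have W: "?W \<in> Linf \<Omega>" by (rule inverse_flux_Linf[OF sol])
  obtain w h where w: "\<And>n::nat. C1_fun (w n) (h n)"
    "\<And>n x. x \<in> closure \<Omega> \<Longrightarrow> \<bar>w n x - u x\<bar> \<le> 1 / real (Suc n)"
    "\<And>n x. x \<in> closure \<Omega> \<Longrightarrow> norm (h n x) \<le> 1"
    by (rule smooth_approximation_sequence[OF K(1,3) Linf_measurable[OF K(2)] K(4)]) auto
  have sub: "x \<in> \<Omega> \<Longrightarrow> x \<in> closure \<Omega>" for x using closure_subset by blast
  have null: "(\<lambda>n. 1 / real (Suc n)) \<longlonglongrightarrow> 0" by (rule LIMSEQ_Suc[OF lim_1_over_n])
  have uL: "u \<in> Linf \<Omega>" using K(1) by (rule Linf_continuous)
  have wL: "w n \<in> Linf \<Omega>" "h n \<in> Linf \<Omega>" for n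
    using C1_fun_continuous[OF w(1)] C1_fun_continuous_grad[OF w(1)] by (auto intro: Linf_continuous)
  have "C1_closure \<Omega> (w n) (h n)" for n
    unfolding C1_closure_def
    using C1_fun_continuous[OF w(1)] C1_fun_continuous_grad[OF w(1)] C1_fun_GDERIV[OF w(1)] by blast
  then have eq: "(LINT x|\<mu>. (?G x \<bullet> h n x) / sqrt (1 - (norm (?G x))\<^sup>2)) = lam * (LINT x|\<mu>. a x * odd_power (u x) * w n x)" for n
    using sol unfolding is_solution_def odd_power_def by blast
  have split: "(LINT x|\<mu>. (?G x \<bullet> H x) / sqrt (1 - (norm (?G x))\<^sup>2)) = (\<Sum>b\<in>Basis. LINT x|\<mu>. (H x \<bullet> b) * ((?G x \<bullet> b) * ?W x))"
    if H: "H \<in> Linf \<Omega>" for H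
  proof -
    have "(LINT x|\<mu>. (?G x \<bullet> H x) / sqrt (1 - (norm (?G x))\<^sup>2)) = (LINT x|\<mu>. (\<Sum>b\<in>Basis. (H x \<bullet> b) * ((?G x \<bullet> b) * ?W x)))"
    proof (rule Bochner_Integration.integral_cong[OF refl])
      fix x
      show "(?G x \<bullet> H x) / sqrt (1 - (norm (?G x))\<^sup>2) = (\<Sum>b\<in>Basis. (H x \<bullet> b) * ((?G x \<bullet> b) * ?W x))"
        by (subst euclidean_inner[of "?G x" "H x"]) (simp add: sum_divide_distrib mult_ac)
    qed
    also have "\<dots> = (\<Sum>b\<in>Basis. LINT x|\<mu>. (H x \<bullet> b) * ((?G x \<bullet> b) * ?W x))"
      by (rule Bochner_Integration.integral_sum)
         (intro Linf_integrable Linf_mult Linf_inner H K(2) W Linf_const)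
    finally show ?thesis .
  qed
  have "(\<lambda>n. \<Sum>b\<in>Basis. LINT x|\<mu>. (h n x \<bullet> b) * ((?G x \<bullet> b) * ?W x)) \<longlonglongrightarrow>
      (\<Sum>b\<in>Basis. LINT x|\<mu>. (?G x \<bullet> b) * ((?G x \<bullet> b) * ?W x))"
  proof (rule tendsto_sum)
    fix b :: 'a assume b: "b \<in> Basis"
    show "(\<lambda>n. LINT x|\<mu>. (h n x \<bullet> b) * ((?G x \<bullet> b) * ?W x)) \<longlonglongrightarrow> (LINT x|\<mu>. (?G x \<bullet> b) * ((?G x \<bullet> b) * ?W x))"
    proof (rule weak_gradient_limit[OF C1_has_weak_gradient[OF w(1)] wL(1) Linf_measurable[OF wL(2)] _ K(3) uL K(2) _ null _ b])
      show "AE x in \<mu>. norm (h n x) \<le> 1" for n by (rule AE_domI) (intro w(3) sub)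
      show "\<bar>w n x - u x\<bar> \<le> 1 / real (Suc n)" if "x \<in> \<Omega>" for n x using that by (intro w(2) sub)
      show "(\<lambda>x. (?G x \<bullet> b) * ?W x) \<in> Linf \<Omega>" by (intro Linf_mult Linf_inner K(2) W Linf_const)
    qed
  qed
  then have "(\<lambda>n. lam * (LINT x|\<mu>. a x * odd_power (u x) * w n x)) \<longlonglongrightarrow> (LINT x|\<mu>. (?G x \<bullet> ?G x) / sqrt (1 - (norm (?G x))\<^sup>2))"
    by (simp only: split[OF wL(2), symmetric] split[OF K(2), symmetric] eq)
  moreover have "(\<lambda>n. lam * (LINT x|\<mu>. a x * odd_power (u x) * w n x)) \<longlonglongrightarrow> lam * (LINT x|\<mu>. a x * odd_power (u x) * u x)"
  proof (rule tendsto_mult[OF tendsto_const])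
    have aj: "(\<lambda>x. a x * odd_power (u x)) \<in> Linf \<Omega>" by (rule weighted_odd_power_Linf[OF K(1)])
    obtain A where A: "A \<ge> 0" "AE x in \<mu>. norm (a x * odd_power (u x)) \<le> A" using aj by (rule Linf_boundE)
    obtain B where B: "B \<ge> 0" "AE x in \<mu>. norm (u x) \<le> B" using uL by (rule Linf_boundE)
    show "(\<lambda>n. LINT x|\<mu>. a x * odd_power (u x) * w n x) \<longlonglongrightarrow> (LINT x|\<mu>. a x * odd_power (u x) * u x)"
    proof (rule integral_bounded_convergence[where C="A * (B + 1)"])
      show "AE x in \<mu>. (\<lambda>n. a x * odd_power (u x) * w n x) \<longlonglongrightarrow> a x * odd_power (u x) * u x"
      proof (rule AE_domI, rule tendsto_mult[OF tendsto_const])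
        fix x assume "x \<in> \<Omega>"
        then have x: "x \<in> closure \<Omega>" by (rule sub)
        show "(\<lambda>n. w n x) \<longlonglongrightarrow> u x"
        proof (rule LIM_zero_cancel, rule tendsto_0_le[where K=1, OF null])
          show "\<forall>\<^sub>F n in sequentially. norm (w n x - u x) \<le> norm (1 / real (Suc n)) * 1"
            using w(2)[OF x] by (intro always_eventually allI) simp
        qed
      qed
      have "AE x in \<mu>. x \<in> \<Omega>" by (rule AE_domI)
      then show "AE x in \<mu>. \<bar>a x * odd_power (u x) * w n x\<bar> \<le> A * (B + 1)" for n
        using A(2) B(2)
      proof eventually_elim
        case (elim x)
        have "1 / real (Suc n) \<le> 1" by simp
        then have "\<bar>w n x\<bar> \<le> B + 1" using w(2)[OF sub[OF elim(1)], of n] elim(3)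
          unfolding real_norm_def by linarith
        then show ?case unfolding abs_mult[of _ "w n x"] using elim(2) A(1) by (intro mult_mono) auto
      qed
    qed (intro Linf_measurable Linf_mult aj wL uL)+
  qed
  ultimately have "(LINT x|\<mu>. (?G x \<bullet> ?G x) / sqrt (1 - (norm (?G x))\<^sup>2)) = lam * (LINT x|\<mu>. a x * odd_power (u x) * u x)"
    by (rule LIMSEQ_unique)
  then show ?thesis by (simp add: power2_norm_eq_inner weighted_integral_def mult.assoc odd_power_mult_self)
qed

text \<open>
  With \<open>m = |\<nabla>u|\<close> one has \<open>1 / sqrt (1 - m^2) = sqrt (1 - m^2) + m^2 / sqrt (1 - m^2)\<close>. The first term
  is at most \<open>1\<close>; the integral of the second is \<open>lam\<close> times the weighted integral of \<open>u\<close>, which the sign of the energy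
  bounds by \<open>p vol\<close>. The resulting bound is independent of \<open>lam\<close>.
\<close>

lemma solution_weak_bound:
  assumes sol: "is_solution \<Omega> a p lam u" and E: "energy \<Omega> a p lam u \<ge> 0"
    and C1: "C1_closure \<Omega> \<phi> g" and gL: "\<And>x. x \<in> \<Omega> \<Longrightarrow> norm (g x) \<le> L" and L: "L \<ge> 0"
  shows "\<bar>lam * (LINT x|\<mu>. a x * odd_power (u x) * \<phi> x)\<bar> \<le> L * ((1 + p) * vol)"
proof -
  let ?G = "weak_grad \<Omega> u"
  let ?W = "\<lambda>x. 1 / sqrt (1 - (norm (?G x))\<^sup>2)"
  have Kset: "u \<in> K_set \<Omega>" using sol by (rule solution_K_set)
  note K = K_setD[OF Kset]
  have W: "?W \<in> Linf \<Omega>" by (rule inverse_flux_Linf[OF sol])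
  obtain r where r: "r < 1" "AE x in \<mu>. norm (?G x) \<le> r"
    using sol by (rule solution_strict_bound)
  have g: "g \<in> Linf \<Omega>" using C1 by (intro Linf_continuous) (simp add: C1_closure_def)
  have nG: "(\<lambda>x. (norm (?G x))\<^sup>2) \<in> Linf \<Omega>" using K(2) by (rule Linf_compose) (intro continuous_intros)
  have "lam / p * weighted_integral u \<le> psi u" using E by (simp add: energy_K[OF Kset])
  then have "lam * weighted_integral u \<le> p * psi u" using exponent by (simp add: field_simps)
  also have "\<dots> \<le> p * vol" using psi_le_vol[OF Kset] exponent by (intro mult_left_mono) auto
  finally have "lam * weighted_integral u \<le> p * vol" .
  have "(LINT x|\<mu>. (?G x \<bullet> g x) / sqrt (1 - (norm (?G x))\<^sup>2)) = lam * (LINT x|\<mu>. a x * odd_power (u x) * \<phi> x)"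
    using sol C1 unfolding is_solution_def odd_power_def by blast
  then have "lam * (LINT x|\<mu>. a x * odd_power (u x) * \<phi> x) = (LINT x|\<mu>. (?G x \<bullet> g x) / sqrt (1 - (norm (?G x))\<^sup>2))"
    by (rule sym)
  also have "\<bar>\<dots>\<bar> \<le> (LINT x|\<mu>. \<bar>(?G x \<bullet> g x) / sqrt (1 - (norm (?G x))\<^sup>2)\<bar>)"
    by (rule integral_abs_bound)
  also have "\<dots> \<le> (LINT x|\<mu>. L * (1 + (norm (?G x))\<^sup>2 * ?W x))"
  proof (rule integral_mono_AE)
    have "(\<lambda>x. \<bar>(?G x \<bullet> g x) * ?W x\<bar>) \<in> Linf \<Omega>"
      by (rule Linf_compose[OF _ continuous_on_rabs[OF continuous_on_id]]) (intro Linf_mult Linf_inner K(2) g W)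
    then show "integrable \<mu> (\<lambda>x. \<bar>(?G x \<bullet> g x) / sqrt (1 - (norm (?G x))\<^sup>2)\<bar>)"
      by (intro Linf_integrable) simp
    show "integrable \<mu> (\<lambda>x. L * (1 + (norm (?G x))\<^sup>2 * ?W x))"
      by (intro Linf_integrable Linf_mult Linf_add Linf_const nG W)
    have "AE x in \<mu>. x \<in> \<Omega>" by (rule AE_domI)
    then show "AE x in \<mu>. \<bar>(?G x \<bullet> g x) / sqrt (1 - (norm (?G x))\<^sup>2)\<bar> \<le> L * (1 + (norm (?G x))\<^sup>2 * ?W x)"
      using r(2)
    proof eventually_elim
      case (elim x)
      define m where "m = norm (?G x)"
      have m: "0 \<le> m" "m < 1" using elim(2) r(1) by (auto simp: m_def)
      then have m2: "m\<^sup>2 < 1" by (simp add: power_less_one_iff)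
      have s: "0 < sqrt (1 - m\<^sup>2)" "sqrt (1 - m\<^sup>2) \<le> 1" using m2 by auto
      have "1 / sqrt (1 - m\<^sup>2) = sqrt (1 - m\<^sup>2) + m\<^sup>2 / sqrt (1 - m\<^sup>2)"
        using s m2 by (simp add: field_simps)
      then have le: "1 / sqrt (1 - m\<^sup>2) \<le> 1 + m\<^sup>2 / sqrt (1 - m\<^sup>2)" using s by linarith
      have "\<bar>?G x \<bullet> g x\<bar> \<le> m * norm (g x)" unfolding m_def by (rule Cauchy_Schwarz_ineq2)
      also have "\<dots> \<le> 1 * L" using m gL[OF elim(1)] by (intro mult_mono) auto
      finally have "\<bar>?G x \<bullet> g x\<bar> * (1 / sqrt (1 - m\<^sup>2)) \<le> L * (1 + m\<^sup>2 / sqrt (1 - m\<^sup>2))"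
        using le L s by (intro mult_mono) auto
      then show ?case using s by (simp add: m_def abs_divide)
    qed
  qed
  also have "\<dots> = L * (vol + (LINT x|\<mu>. (norm (?G x))\<^sup>2 * ?W x))"
    by (simp only: integral_mult_right_zero vol_def)
       (subst Bochner_Integration.integral_add, auto intro!: Linf_integrable Linf_const Linf_mult[OF nG W, simplified])
  also have "\<dots> = L * (vol + lam * weighted_integral u)"
    using solution_tested_with_itself[OF sol] by simp
  also have "\<dots> \<le> L * ((1 + p) * vol)"
    using \<open>lam * weighted_integral u \<le> p * vol\<close> L by (intro mult_left_mono) (auto simp: algebra_simps)
  finally show ?thesis .
qed

text \<open>
  If \<open>|u|\<close> is large at some point \<open>x0\<close>, then \<open>u / u x0\<close> is uniformly close to \<open>1\<close>, because \<open>u\<close> oscillates at most by the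
  diameter of \<open>\<Omega>\<close>. By homogeneity the weighted integral of \<open>odd_power (u / u x0)\<close> vanishes, yet it is
  close to the integral of \<open>a\<close>, which is negative.
\<close>

lemma uniform_bound:
  assumes neg: "(LINT x|\<mu>. a x) < 0"
  obtains M where "\<And>u x. continuous_on (closure \<Omega>) u \<Longrightarrow>
      (\<And>x y. x \<in> closure \<Omega> \<Longrightarrow> y \<in> closure \<Omega> \<Longrightarrow> \<bar>u x - u y\<bar> \<le> norm (x - y)) \<Longrightarrow>
      (LINT x|\<mu>. a x * odd_power (u x)) = 0 \<Longrightarrow> x \<in> closure \<Omega> \<Longrightarrow> \<bar>u x\<bar> \<le> M"
proof -
  define I where "I = \<bar>LINT x|\<mu>. a x\<bar>"
  define A where "A = (LINT x|\<mu>. \<bar>a x\<bar>)"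
  have I: "I > 0" using neg by (simp add: I_def)
  have A: "A \<ge> 0" by (simp add: A_def)
  have "isCont odd_power 1" using continuous_on_odd_power by (simp add: continuous_on_eq_continuous_at)
  moreover have "I / (A + 1) > 0" using I A by simp
  ultimately obtain d where d: "d > 0" "\<And>t. \<bar>t - 1\<bar> < d \<Longrightarrow> \<bar>odd_power t - odd_power 1\<bar> < I / (A + 1)"
    unfolding continuous_at_eps_delta dist_real_def by metis
  have j1: "odd_power 1 = 1" by (simp add: odd_power_def)
  have "bounded (closure \<Omega>)" using bounded_dom by (rule bounded_closure)
  then obtain D where D: "\<forall>x\<in>closure \<Omega>. \<forall>y\<in>closure \<Omega>. dist x y \<le> D"
    using bounded_two_points by metis
  have D0: "D \<ge> 0" using D nonempty_dom closure_subset zero_le_dist order_trans by (metis ex_in_conv subsetD)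
  show ?thesis
  proof (rule that[of "D / d + 1"], rule ccontr)
    fix u x0
    assume c: "continuous_on (closure \<Omega>) u"
      and lip: "\<And>x y. x \<in> closure \<Omega> \<Longrightarrow> y \<in> closure \<Omega> \<Longrightarrow> \<bar>u x - u y\<bar> \<le> norm (x - y)"
      and 0: "(LINT x|\<mu>. a x * odd_power (u x)) = 0" and x0: "x0 \<in> closure \<Omega>"
      and "\<not> \<bar>u x0\<bar> \<le> D / d + 1"
    then have m: "\<bar>u x0\<bar> > D / d" "u x0 \<noteq> 0" using D0 d(1) by (auto simp: add_nonneg_pos)
    define v where "v x = u x / u x0" for x
    have vc: "continuous_on (closure \<Omega>) v" unfolding v_def using c m(2) by (intro continuous_intros) auto
    have "(LINT x|\<mu>. a x * odd_power (u x)) = (LINT x|\<mu>. odd_power (u x0) * (a x * odd_power (v x)))"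
    proof (rule Bochner_Integration.integral_cong[OF refl])
      fix x
      have "odd_power (u x) = odd_power (u x0) * odd_power (v x)" using m(2) by (simp add: v_def flip: odd_power_mult)
      then show "a x * odd_power (u x) = odd_power (u x0) * (a x * odd_power (v x))" by simp
    qed
    then have v0: "(LINT x|\<mu>. a x * odd_power (v x)) = 0" using 0 m(2) by (simp add: odd_power_eq_0)
    have aL: "(\<lambda>x. \<bar>a x\<bar>) \<in> Linf \<Omega>" using weight by (rule Linf_compose) (intro continuous_intros)
    have jL: "(\<lambda>x. odd_power (v x)) \<in> Linf \<Omega>" by (intro Linf_compose[OF _ continuous_on_odd_power] Linf_continuous vc)
    have "(LINT x|\<mu>. a x) = (LINT x|\<mu>. a x) - (LINT x|\<mu>. a x * odd_power (v x))" using v0 by simp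
    also have "\<dots> = (LINT x|\<mu>. (1 - odd_power (v x)) * a x)"
      by (subst Bochner_Integration.integral_diff[symmetric])
         (auto intro!: Linf_integrable Linf_mult weight jL simp: algebra_simps)
    finally have "I = \<bar>LINT x|\<mu>. (1 - odd_power (v x)) * a x\<bar>" by (simp add: I_def)
    also have "\<dots> \<le> I / (A + 1) * A"
      unfolding A_def
    proof (rule integral_mult_bound)
      show "(\<lambda>x. 1 - odd_power (v x)) \<in> Linf \<Omega>" by (intro Linf_diff Linf_const jL)
      show "AE x in \<mu>. \<bar>1 - odd_power (v x)\<bar> \<le> I / ((LINT x|\<mu>. \<bar>a x\<bar>) + 1)"
        unfolding A_def[symmetric]
      proof (rule AE_domI)
        fix x assume "x \<in> \<Omega>"
        then have x: "x \<in> closure \<Omega>" using closure_subset by blast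
        have "\<bar>v x - 1\<bar> = \<bar>u x - u x0\<bar> / \<bar>u x0\<bar>" using m(2) by (simp add: v_def diff_divide_distrib flip: abs_divide)
        also have "\<dots> \<le> D / \<bar>u x0\<bar>"
          using lip[OF x x0] D x x0 by (intro divide_right_mono) (auto simp: dist_norm intro: order_trans)
        also have "\<dots> < d" using m d(1) by (simp add: field_simps)
        finally show "\<bar>1 - odd_power (v x)\<bar> \<le> I / (A + 1)" using d(2) j1 by (simp add: abs_minus_commute less_imp_le)
      qed
    qed (rule weight)
    also have "\<dots> < I" using I A by (simp add: field_simps)
    finally show False by simp
  qed
qed

text \<open>
  Along a sequence \<open>lam \<rightarrow> \<infinity>\<close> on which the supremum stays above some \<open>e > 0\<close>, the solutions are
  bounded and Lipschitz with constant \<open>1\<close>; a subsequence converges uniformly to some \<open>g\<close>. By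
  \<open>solution_weak_bound\<close> the function \<open>a |g|^(p-2) g\<close> is orthogonal to all test functions, whence
  \<open>g = 0\<close>, a contradiction.
\<close>

lemma solutions_tend_to_zero:
  fixes u :: "real \<Rightarrow> 'a \<Rightarrow> real"
  assumes neg: "(LINT x|\<mu>. a x) < 0" and a0: "{x \<in> \<Omega>. a x = 0} \<in> null_sets lebesgue"
    and sol: "\<And>lam. lam > \<Lambda> \<Longrightarrow> is_solution \<Omega> a p lam (u lam)"
    and E: "\<And>lam. lam > \<Lambda> \<Longrightarrow> energy \<Omega> a p lam (u lam) \<ge> 0"
  shows "uniform_limit (closure \<Omega>) u (\<lambda>_. 0) at_top"
proof (rule ccontr)
  assume "\<not> uniform_limit (closure \<Omega>) u (\<lambda>_. 0) at_top"
  then obtain e where e: "e > 0" "\<not> (\<forall>\<^sub>F lam in at_top. \<forall>x\<in>closure \<Omega>. dist (u lam x) 0 < e)"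
    unfolding uniform_limit_iff by blast
  have "\<exists>lam. lam \<ge> max (real n) (\<bar>\<Lambda>\<bar> + 1) \<and> (\<exists>x\<in>closure \<Omega>. e \<le> \<bar>u lam x\<bar>)" (is "?ex n") for n
  proof (rule ccontr)
    assume neg: "\<not> ?ex n"
    have "\<forall>\<^sub>F lam in at_top. \<forall>x\<in>closure \<Omega>. dist (u lam x) 0 < e"
      using eventually_ge_at_top[of "max (real n) (\<bar>\<Lambda>\<bar> + 1)"]
    proof eventually_elim
      case (elim lam)
      then have "\<not> (\<exists>x\<in>closure \<Omega>. e \<le> \<bar>u lam x\<bar>)" using neg by blast
      then show ?case by (simp add: not_le)
    qed
    with e(2) show False ..
  qed
  then have "\<forall>n. \<exists>lam. lam \<ge> max (real n) (\<bar>\<Lambda>\<bar> + 1) \<and> (\<exists>x\<in>closure \<Omega>. e \<le> \<bar>u lam x\<bar>)" by blast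
  from choice[OF this] obtain l where "\<forall>n. l n \<ge> max (real n) (\<bar>\<Lambda>\<bar> + 1) \<and> (\<exists>x\<in>closure \<Omega>. e \<le> \<bar>u (l n) x\<bar>)" by blast
  then have l0: "l n \<ge> max (real n) (\<bar>\<Lambda>\<bar> + 1)" "\<exists>x\<in>closure \<Omega>. e \<le> \<bar>u (l n) x\<bar>" for n by blast+
  have l: "l n \<ge> real n" "l n > \<Lambda>" "l n > 0" for n
    using l0(1)[of n] by auto
  define U where "U n = u (l n)" for n
  have solU: "is_solution \<Omega> a p (l n) (U n)" and EU: "energy \<Omega> a p (l n) (U n) \<ge> 0" for n
    unfolding U_def using l(2) by (auto intro: sol E)
  have KU: "U n \<in> K_set \<Omega>" for n by (rule solution_K_set[OF solU])
  note cU = K_setD(1)[OF KU]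
  note lipU = K_set_lipschitz[OF KU]
  obtain M where M: "\<And>u x. continuous_on (closure \<Omega>) u \<Longrightarrow>
      (\<And>x y. x \<in> closure \<Omega> \<Longrightarrow> y \<in> closure \<Omega> \<Longrightarrow> \<bar>u x - u y\<bar> \<le> norm (x - y)) \<Longrightarrow>
      (LINT x|\<mu>. a x * odd_power (u x)) = 0 \<Longrightarrow> x \<in> closure \<Omega> \<Longrightarrow> \<bar>u x\<bar> \<le> M"
    by (rule uniform_bound[OF neg]) blast
  have mean0: "(LINT x|\<mu>. a x * odd_power (U n x)) = 0" for n
  proof -
    have "C1_closure \<Omega> (\<lambda>_. 1) (\<lambda>_. 0)" by (auto simp: C1_closure_def GDERIV_const)
    from solution_weak_bound[OF solU EU this, of 0 n] show ?thesis using l(3)[of n] by simp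
  qed
  have UM: "\<bar>U n x\<bar> \<le> M" if "x \<in> closure \<Omega>" for n x by (rule M[OF cU lipU mean0 that])
  have comp: "compact (closure \<Omega>)" using bounded_dom by (simp add: compact_closure)
  obtain g k where g: "continuous_on (closure \<Omega>) g" and k: "strict_mono (k :: nat \<Rightarrow> nat)"
    and lim: "\<And>e. 0 < e \<Longrightarrow> \<exists>N. \<forall>n x. n \<ge> N \<and> x \<in> closure \<Omega> \<longrightarrow> norm (U (k n) x - g x) < e"
  proof (rule Arzela_Ascoli[OF comp, of U M])
    show "norm (U n x) \<le> M" if "x \<in> closure \<Omega>" for n x using UM[OF that] by simp
    show "\<exists>d>0. \<forall>n y. y \<in> closure \<Omega> \<and> norm (x - y) < d \<longrightarrow> norm (U n x - U n y) < e"
      if "x \<in> closure \<Omega>" "0 < e" for x e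
    proof (intro exI[of _ e] conjI allI impI)
      fix n y assume y: "y \<in> closure \<Omega> \<and> norm (x - y) < e"
      then have "\<bar>U n x - U n y\<bar> \<le> norm (x - y)" using that(1) by (intro lipU) auto
      then show "norm (U n x - U n y) < e" using y by simp
    qed (rule that(2))
  qed blast
  have ptw: "(\<lambda>n. U (k n) x) \<longlonglongrightarrow> g x" if "x \<in> closure \<Omega>" for x
    unfolding LIMSEQ_iff using lim that by blast
  have kn: "real n \<le> l (k n)" for n
    using l(1)[of "k n"] seq_suble[OF k, of n] by linarith
  have AE0: "AE x in \<mu>. a x * odd_power (g x) = 0"
  proof (rule fundamental_lemma)
    show "(\<lambda>x. a x * odd_power (g x)) \<in> Linf \<Omega>" by (rule weighted_odd_power_Linf[OF g])
    fix \<phi> h assume t: "test_function \<Omega> \<phi> h"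
    note tL = test_function_Linf[OF t]
    have C1: "C1_fun \<phi> h" using t by (rule test_function_C1)
    have Cc: "C1_closure \<Omega> \<phi> h"
      unfolding C1_closure_def using C1_fun_continuous[OF C1] C1_fun_continuous_grad[OF C1] C1_fun_GDERIV[OF C1] by blast
    have "bounded (h ` closure \<Omega>)"
      using comp by (intro compact_imp_bounded compact_continuous_image C1_fun_continuous_grad[OF C1])
    then obtain L where L: "L > 0" "\<forall>y\<in>h ` closure \<Omega>. norm y \<le> L" using bounded_pos by metis
    define C where "C = L * ((1 + p) * vol)"
    have bnd: "\<bar>LINT x|\<mu>. a x * odd_power (U n x) * \<phi> x\<bar> \<le> C / l n" for n
    proof -
      have "\<bar>l n * (LINT x|\<mu>. a x * odd_power (U n x) * \<phi> x)\<bar> \<le> C"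
        unfolding C_def
      proof (rule solution_weak_bound[OF solU EU Cc])
        show "norm (h x) \<le> L" if "x \<in> \<Omega>" for x using L(2) that closure_subset[of \<Omega>] by blast
      qed (use L in simp)
      then show ?thesis using l(3)[of n] by (simp add: abs_mult field_simps)
    qed
    have "(\<lambda>n. LINT x|\<mu>. a x * odd_power (U (k n) x) * \<phi> x) \<longlonglongrightarrow> 0"
    proof (rule tendsto_0_le[where K=1])
      show "(\<lambda>n. C / l (k n)) \<longlonglongrightarrow> 0"
        using kn by (intro tendsto_divide_0[OF tendsto_const] filterlim_at_top_imp_at_infinity
            filterlim_at_top_mono[OF filterlim_real_sequentially]) auto
      show "\<forall>\<^sub>F n in sequentially. norm (LINT x|\<mu>. a x * odd_power (U (k n) x) * \<phi> x) \<le> norm (C / l (k n)) * 1"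
        using order_trans[OF bnd abs_ge_self]
        by (intro always_eventually allI) (simp only: real_norm_def mult_1_right)
    qed
    moreover have "(\<lambda>n. LINT x|\<mu>. a x * odd_power (U (k n) x) * \<phi> x) \<longlonglongrightarrow> (LINT x|\<mu>. a x * odd_power (g x) * \<phi> x)"
    proof -
      have a\<phi>: "(\<lambda>x. a x * \<phi> x) \<in> Linf \<Omega>" by (intro Linf_mult weight tL)
      obtain A where A: "A \<ge> 0" "AE x in \<mu>. norm (a x * \<phi> x) \<le> A" using a\<phi> by (rule Linf_boundE)
      have "bounded (odd_power ` cball 0 M)"
        by (intro compact_imp_bounded compact_continuous_image continuous_on_subset[OF continuous_on_odd_power]) auto
      then obtain J where J: "J > 0" "\<forall>y\<in>odd_power ` cball 0 M. norm y \<le> J" using bounded_pos by metis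
      show ?thesis
      proof (rule integral_bounded_convergence[where C="A * J"])
        show "AE x in \<mu>. (\<lambda>n. a x * odd_power (U (k n) x) * \<phi> x) \<longlonglongrightarrow> a x * odd_power (g x) * \<phi> x"
        proof (rule AE_domI, intro tendsto_mult tendsto_const)
          fix x assume "x \<in> \<Omega>"
          then have "x \<in> closure \<Omega>" using closure_subset by blast
          then show "(\<lambda>n. odd_power (U (k n) x)) \<longlonglongrightarrow> odd_power (g x)"
            using continuous_on_tendsto_compose[OF continuous_on_odd_power ptw] by simp
        qed
        have "AE x in \<mu>. x \<in> \<Omega>" by (rule AE_domI)
        then show "AE x in \<mu>. \<bar>a x * odd_power (U (k n) x) * \<phi> x\<bar> \<le> A * J" for n
          using A(2)
        proof eventually_elim
          case (elim x)
          then have "\<bar>U (k n) x\<bar> \<le> M" using closure_subset[of \<Omega>] by (intro UM) auto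
          then have "\<bar>odd_power (U (k n) x)\<bar> \<le> J" using J(2) by auto
          then have "\<bar>a x * \<phi> x\<bar> * \<bar>odd_power (U (k n) x)\<bar> \<le> A * J" using elim A(1) by (intro mult_mono) auto
          then show ?case by (simp add: abs_mult mult_ac)
        qed
      qed (intro Linf_measurable Linf_mult weighted_odd_power_Linf cU g tL)+
    qed
    ultimately show "(LINT x|\<mu>. a x * odd_power (g x) * \<phi> x) = 0" by (intro LIMSEQ_unique)
  qed
  have "AE x in lebesgue. x \<notin> {x \<in> \<Omega>. a x = 0}" using a0 by (rule AE_not_in)
  then have "AE x in \<mu>. a x \<noteq> 0" using dom_lebesgue by (simp add: AE_restrict_space_iff)
  with AE0 have g0: "AE x in \<mu>. g x = 0" by eventually_elim (simp add: odd_power_eq_0)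
  have gdom: "g x = 0" if x: "x \<in> \<Omega>" for x
  proof (rule ccontr)
    assume "g x \<noteq> 0"
    have "continuous_on \<Omega> g" using g closure_subset by (rule continuous_on_subset)
    then have "open (\<Omega> \<inter> g -` (- {0}))"
      using open_dom by (rule continuous_open_preimage) auto
    moreover have "x \<in> (\<Omega> \<inter> g -` (- {0}))" using x \<open>g x \<noteq> 0\<close> by simp
    ultimately obtain r where r: "r > 0" "ball x r \<subseteq> (\<Omega> \<inter> g -` (- {0}))"
      using open_contains_ball by blast
    then have "\<exists>y\<in>ball x r. g y = 0" using g0 by (intro ball_not_AE) auto
    then show False using r(2) by blast
  qed
  have gcl: "g x = 0" if "x \<in> closure \<Omega>" for x
    using continuous_constant_on_closure[OF g _ that, of 0] gdom by blast
  obtain n where n: "\<And>x. x \<in> closure \<Omega> \<Longrightarrow> norm (U (k n) x - g x) < e" using lim[OF e(1)] by blast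
  obtain x where x: "x \<in> closure \<Omega>" "e \<le> \<bar>u (l (k n)) x\<bar>" using l0(2) by blast
  show False using n[OF x(1)] x(2) gcl[OF x(1)] by (simp add: U_def)
qed

end

section \<open>Asymptotics of the mountain-pass solutions\<close>

theorem proposition4p4:
  fixes \<Omega> :: "'a::euclidean_space set"
    and a :: "'a \<Rightarrow> real"
    and p \<Lambda> :: real
    and u_l u_s :: "real \<Rightarrow> 'a \<Rightarrow> real"
    and c :: "real \<Rightarrow> ereal"
  assumes dim: "DIM('a) \<ge> 2"
    and domain: "open \<Omega>" "\<Omega> \<noteq> {}" "bounded \<Omega>" "convex \<Omega>" "C2_boundary \<Omega>"
    and p: "p > 2"
    and a_star: "a \<in> Linf \<Omega>" "(LINT x|lebesgue_on \<Omega>. a x) < 0"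
    and a_plus: "interior {x \<in> \<Omega>. a x > 0} \<noteq> {}"
    and a_zero: "{x \<in> \<Omega>. a x = 0} \<in> null_sets lebesgue"
    and Lambda: "\<Lambda> > 0"
    and ground_state: "\<And>lam. lam > \<Lambda> \<Longrightarrow> is_ground_state \<Omega> a p lam (u_l lam)"
    and level: "\<And>lam. lam > \<Lambda> \<Longrightarrow> c lam = mountain_pass_level \<Omega> a p lam (u_l lam)"
    and mountain_pass: "\<And>lam. lam > \<Lambda> \<Longrightarrow>
          is_solution \<Omega> a p lam (u_s lam) \<and> energy \<Omega> a p lam (u_s lam) = c lam"
  shows "(\<forall>lam>\<Lambda>. \<bar>c lam\<bar> \<noteq> \<infinity>) \<and>
         (\<lambda>lam. real_of_ereal (c lam)) \<in> O[at_top](\<lambda>lam. lam powr (- (2 / (p - 2)))) \<and>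
         uniform_limit (closure \<Omega>) u_s (\<lambda>_. 0) at_top"
proof -
  interpret weighted_domain \<Omega> a p
    using domain a_star(1) p by unfold_locales
  have K_l: "u_l lam \<in> K_set \<Omega>" and K_s: "u_s lam \<in> K_set \<Omega>" if "lam > \<Lambda>" for lam
    using ground_state[OF that] mountain_pass[OF that] by (auto simp: is_ground_state_def intro: solution_K_set)
  have c_energy: "c lam = ereal (psi (u_s lam) - lam / p * weighted_integral (u_s lam))" if "lam > \<Lambda>" for lam
    using mountain_pass[OF that] energy_K[OF K_s[OF that]] by simp
  have c_nonneg: "c lam \<ge> 0" if "lam > \<Lambda>" for lam
    using level[OF that] mountain_pass_level_nonneg by simp
  obtain \<phi> where \<phi>: "\<phi> \<in> K_set \<Omega>" "weighted_integral \<phi> > 0" using a_plus by (rule exists_positive_weighted_integral)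
  define B where "B = weighted_integral \<phi> / (2 * p)"
  have B: "B > 0" using \<phi>(2) p by (simp add: B_def)
  define C where "C = vol * (vol / B) powr (2 / (p - 2))"
  have c_le: "c lam \<le> ereal (C * lam powr (- (2 / (p - 2))))"
    if lam: "lam > \<Lambda>" "lam \<ge> 2 * p * vol / weighted_integral \<phi>" for lam
  proof -
    have pos: "lam > 0" using lam(1) Lambda by simp
    have "weighted_integral (u_l lam) \<ge> weighted_integral \<phi> / 2"
      using ground_state[OF lam(1)]
      by (intro minimizer_weighted_integral_lower_bound[OF K_l[OF lam(1)] _ \<phi> pos lam(2)]) (simp add: is_ground_state_def)
    then have "p * B \<le> weighted_integral (u_l lam)" using p by (simp add: B_def)
    from mountain_pass_level_le[OF K_l[OF lam(1)] B this pos]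
    show ?thesis unfolding C_def level[OF lam(1)] .
  qed
  have "(\<lambda>lam. real_of_ereal (c lam)) \<in> O[at_top](\<lambda>lam. lam powr (- (2 / (p - 2))))"
  proof (rule bigoI[of _ C])
    show "\<forall>\<^sub>F lam in at_top. norm (real_of_ereal (c lam)) \<le> C * norm (lam powr (- (2 / (p - 2))))"
      using eventually_gt_at_top[of \<Lambda>] eventually_ge_at_top[of "2 * p * vol / weighted_integral \<phi>"]
    proof eventually_elim
      case (elim lam)
      have "real_of_ereal (c lam) \<ge> 0" using c_nonneg[OF elim(1)] by (rule real_of_ereal_pos)
      moreover have "real_of_ereal (c lam) \<le> C * lam powr (- (2 / (p - 2)))"
        using c_le[OF elim] c_energy[OF elim(1)] by simp
      ultimately show ?case by (simp only: real_norm_def abs_of_nonneg powr_ge_zero)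
    qed
  qed
  moreover have "uniform_limit (closure \<Omega>) u_s (\<lambda>_. 0) at_top"
    using mountain_pass c_nonneg by (intro solutions_tend_to_zero[OF a_star(2) a_zero, of \<Lambda>]) auto
  moreover have "\<forall>lam>\<Lambda>. \<bar>c lam\<bar> \<noteq> \<infinity>" using c_energy by simp
  ultimately show ?thesis by blast
qed

end
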